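(* Let $X \subset \mathbb{R}$ be a set of positive Lebesgue outer measure. Then there is a set $Y \subseteq X$ such that $Y$ is full in $X$ and for any two distinct points $y, y' \in Y$ the distance $|y - y'|$ is irrational.
   Context: For a set $A \subseteq \mathbb{R}$, a $G_\delta$ measurable envelope $\mathrm{env}(A)$ is a $G_\delta$ set containing $A$ such that the Lebesgue inner measure of $\mathrm{env}(A) \setminus A$ is zero (it is unique up to a Lebesgue-null set). For $B \subseteq A$, say $B$ is full in $A$ if $\mathrm{env}(B) = \mathrm{env}(A)$ modulo a null set; when $A$ has finite outer measure this is equivalent to $B$ and $A$ having the same Lebesgue outer measure. *)

theory Defs
  imports "HOL-Analysis.Analysis"
begin

definition inner_measure_of :: "'a measure \<Rightarrow> 'a set \<Rightarrow> ennreal" where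
  "inner_measure_of M A = (SUP B \<in> {B \<in> sets M. B \<subseteq> A}. emeasure M B)"

text \<open>An envelope is determined only up to a null set, so it is rendered as a relation
  between a set and its possible envelopes.\<close>

definition gdelta_envelope :: "real set \<Rightarrow> real set \<Rightarrow> bool" where
  "gdelta_envelope A E \<longleftrightarrow> gdelta E \<and> A \<subseteq> E \<and> inner_measure_of lebesgue (E - A) = 0"

text \<open>The choice of the two envelopes is immaterial: by \<open>gdelta_envelope_exists\<close> and
  \<open>gdelta_envelope_unique\<close> below, the existential quantifiers can be replaced by
  universal ones, see \<open>full_in_iff\<close>.\<close>

definition full_in :: "real set \<Rightarrow> real set \<Rightarrow> bool" where
  "full_in B A \<longleftrightarrow> B \<subseteq> A \<and>
     (\<exists>E F. gdelta_envelope B E \<and> gdelta_envelope A F \<and>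
            (E - F) \<union> (F - E) \<in> null_sets lebesgue)"

lemma gdelta_in_sets_lebesgue:
  fixes E :: "real set"
  assumes "gdelta E"
  shows "E \<in> sets lebesgue"
  using assms
proof cases
  case (1 U)
  have "U n \<in> sets borel" for n
    using 1 by (simp add: borel_open)
  then have "E \<in> sets borel"
    unfolding 1(1) by (intro sets.countable_INT) auto
  then show ?thesis
    by (simp add: sets_completionI_sets)
qed

lemma inner_measure_of_eq_0_iff:
  "inner_measure_of M A = 0 \<longleftrightarrow> (\<forall>B \<in> sets M. B \<subseteq> A \<longrightarrow> emeasure M B = 0)"
proof -
  have "inner_measure_of M A = 0 \<longleftrightarrow> inner_measure_of M A \<le> 0"
    by simp
  also have "\<dots> \<longleftrightarrow> (\<forall>B \<in> sets M. B \<subseteq> A \<longrightarrow> emeasure M B = 0)"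
    unfolding inner_measure_of_def SUP_le_iff by auto
  finally show ?thesis .
qed

lemma gdelta_envelope_iff_measurable_envelope:
  "gdelta_envelope A E \<longleftrightarrow> gdelta E \<and> measurable_envelope lebesgue A E"
proof (cases "gdelta E \<and> A \<subseteq> E")
  case True
  then have "measurable_envelope lebesgue A E \<longleftrightarrow> inner_measure_of lebesgue (E - A) = 0"
    by (subst measurable_envelope_eq1) (auto simp: gdelta_in_sets_lebesgue inner_measure_of_eq_0_iff)
  then show ?thesis
    using True by (simp add: gdelta_envelope_def)
next
  case False
  then show ?thesis
    by (auto simp: gdelta_envelope_def measurable_envelope_def)
qed

lemma gdelta_envelope_exists: "\<exists>E. gdelta_envelope A E"
proof -
  define C where "C n = {- real n .. real n}" for n
  have "A \<subseteq> (\<Union>n. C n)"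
  proof
    fix x
    obtain n where "\<bar>x\<bar> \<le> real n"
      using real_arch_simple by blast
    then show "x \<in> (\<Union>n. C n)"
      by (auto simp: C_def abs_le_iff intro!: exI[of _ n])
  qed
  moreover have "C n \<in> sets lebesgue" "emeasure lebesgue (C n) < \<infinity>" for n
    by (auto simp: C_def)
  ultimately obtain E where E: "measurable_envelope lebesgue A E"
    using measurable_envelopeI_countable_cover[of A C lebesgue] by auto
  obtain G T where G: "gdelta G" "T \<in> null_sets lebesgue" "E \<union> T = G" "disjnt E T"
    using lebesgue_set_almost_gdelta[OF measurable_envelopeD(2)[OF E]] by blast
  have "emeasure lebesgue B = 0" if B: "B \<in> sets lebesgue" "B \<subseteq> G - A" for B
  proof -
    have T: "T \<in> sets lebesgue"
      using G(2) by auto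
    have "emeasure lebesgue (B - T) = 0"
      using B G T by (intro measurable_envelopeD1[OF E]) auto
    then have "B - T \<in> null_sets lebesgue"
      using B T by auto
    then have "B - T \<union> T \<in> null_sets lebesgue"
      using G(2) by blast
    then have "B \<in> null_sets lebesgue"
      by (rule null_sets_completion_subset[rotated]) auto
    then show ?thesis
      by auto
  qed
  then have "gdelta_envelope A G"
    using G measurable_envelopeD(1)[OF E]
    by (auto simp: gdelta_envelope_def inner_measure_of_eq_0_iff)
  then show ?thesis ..
qed

lemma gdelta_envelope_unique:
  assumes E: "gdelta_envelope A E" and F: "gdelta_envelope A F"
  shows "(E - F) \<union> (F - E) \<in> null_sets lebesgue"
proof -
  have "G - H \<in> null_sets lebesgue" if G: "gdelta_envelope A G" and H: "gdelta_envelope A H" for G H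
  proof -
    have "G - H \<in> sets lebesgue"
      using G H by (intro sets.Diff gdelta_in_sets_lebesgue) (simp_all add: gdelta_envelope_def)
    moreover have "G - H \<subseteq> G - A"
      using H unfolding gdelta_envelope_def by blast
    moreover have "\<forall>B \<in> sets lebesgue. B \<subseteq> G - A \<longrightarrow> emeasure lebesgue B = 0"
      using G unfolding gdelta_envelope_def inner_measure_of_eq_0_iff by blast
    ultimately show ?thesis
      by (intro null_setsI) blast+
  qed
  then show ?thesis
    using E F by (intro null_sets.Un) blast+
qed

lemma full_in_iff:
  assumes E: "gdelta_envelope B E" and F: "gdelta_envelope A F"
  shows "full_in B A \<longleftrightarrow> B \<subseteq> A \<and> (E - F) \<union> (F - E) \<in> null_sets lebesgue"
proof
  assume "full_in B A"
  then obtain E' F' where *: "B \<subseteq> A" "gdelta_envelope B E'" "gdelta_envelope A F'"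
    "(E' - F') \<union> (F' - E') \<in> null_sets lebesgue"
    by (auto simp: full_in_def)
  have "((E - E') \<union> (E' - E)) \<union> ((E' - F') \<union> (F' - E')) \<union> ((F' - F) \<union> (F - F'))
      \<in> null_sets lebesgue"
    using gdelta_envelope_unique[OF E *(2)] gdelta_envelope_unique[OF *(3) F] *(4)
    by blast
  then have "(E - F) \<union> (F - E) \<in> null_sets lebesgue"
    by (rule null_sets_completion_subset[rotated]) blast
  with *(1) show "B \<subseteq> A \<and> (E - F) \<union> (F - E) \<in> null_sets lebesgue" ..
qed (use E F in \<open>auto simp: full_in_def\<close>)

end

theory Submission
  imports Defs "HOL-Analysis.Radon_Nikodym"
begin

text \<open>
  Choosing one representative in each coset of \<open>\<rat>\<close>, we can write \<open>X\<close> as the union of the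
  translates \<open>q n + Y n\<close> of countably many sets \<open>Y n\<close> of representatives. It suffices to find
  pairwise disjoint \<open>Z n \<subseteq> Y n\<close> with \<open>Z n\<close> full in \<open>Y n\<close>, and by recursion and exhaustion it is
  enough to show: if \<open>A\<close> is not null and \<open>F n \<subseteq> A\<close> for all \<open>n\<close>, some non-null \<open>D \<subseteq> A\<close>
  contains no non-null set \<open>F n \<inter> E\<close> with \<open>E\<close> measurable, not even up to a null set.

  Suppose this fails. We may assume that \<open>A\<close> is a union of \<open>\<kappa>\<close> null sets with \<open>\<kappa>\<close> minimal; let
  \<open>f : A \<rightarrow> \<kappa>\<close> be the resulting rank. By Fubini's theorem the sets \<open>f\<^sup>-\<^sup>1 S\<close> split every non-null
  subset of \<open>A\<close>, and a random colouring then yields functions \<open>X m : \<kappa> \<rightarrow> \<nat>\<close> such that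
  \<open>{a \<in> F n. X m (f a) = v}\<close> is almost full in \<open>F n\<close> for all \<open>n \<le> m\<close> and all \<open>v\<close>. For \<open>\<xi> < \<kappa>\<close>
  choose \<open>w \<xi>\<close> outside the null sets \<open>{y. dyadic_code k y = X (X k \<eta>) \<xi> for infinitely many k}\<close>,
  \<open>\<eta> < \<xi>\<close>. Some \<open>G k\<close> is such that finitely many \<open>F n'\<close>, \<open>n' \<le> G k\<close>, decide the \<open>k\<close>-th dyadic
  approximation of \<open>w (f a)\<close> almost everywhere on the envelopes of the \<open>F n\<close>, \<open>n \<le> k\<close>, while
  the values \<open>X m (f a)\<close> with \<open>m \<ge> G k\<close> remain free there. Hence \<open>X k \<eta> < G k\<close> for almost all
  \<open>k\<close>, for every \<open>\<eta>\<close>; but since every value of \<open>X k\<close> is taken almost fully, no single \<open>G\<close>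
  dominates all these sequences.
\<close>

subsection \<open>Null sets and measurable envelopes\<close>

text \<open>Fullness depends only on the null ideal, so Lebesgue measure may be traded for an
  equivalent finite one, which allows continuity from above and exhaustion.\<close>

locale finite_lborel = finite_measure M for M :: "real measure" +
  assumes sets_M [measurable_cong]: "sets M = sets borel"
    and null_sets_M: "null_sets M = null_sets lborel"
begin

lemma space_M [simp]: "space M = UNIV"
  using sets_eq_imp_space_eq[OF sets_M] by simp

definition nul :: "real set \<Rightarrow> bool" where
  "nul B \<longleftrightarrow> (\<exists>N \<in> null_sets M. B \<subseteq> N)"

lemma nul_subset: "nul B \<Longrightarrow> C \<subseteq> B \<Longrightarrow> nul C"
  unfolding nul_def by blast

lemma nul_empty [simp]: "nul {}"
  unfolding nul_def by blast

lemma nul_UN: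
  assumes "countable I" "\<And>i. i \<in> I \<Longrightarrow> nul (B i)"
  shows "nul (\<Union>i\<in>I. B i)"
proof -
  obtain N where N: "\<And>i. i \<in> I \<Longrightarrow> N i \<in> null_sets M \<and> B i \<subseteq> N i"
    using assms(2) unfolding nul_def by metis
  have "(\<Union>i\<in>I. N i) \<in> null_sets M"
    using N assms(1) by (intro null_sets_UN') auto
  moreover have "(\<Union>i\<in>I. B i) \<subseteq> (\<Union>i\<in>I. N i)"
    using N by (intro UN_mono) auto
  ultimately show ?thesis
    unfolding nul_def by (rule rev_bexI)
qed

lemma nul_Un: "nul B \<Longrightarrow> nul C \<Longrightarrow> nul (B \<union> C)"
  unfolding nul_def by (meson Un_mono null_sets.Un)

lemma nul_iff_null_sets: "E \<in> sets M \<Longrightarrow> nul E \<longleftrightarrow> E \<in> null_sets M"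
  unfolding nul_def using null_sets_subset by blast

lemma nul_measure: "E \<in> sets M \<Longrightarrow> nul E \<longleftrightarrow> measure M E = 0"
  by (simp add: nul_iff_null_sets null_sets_def emeasure_eq_measure)

lemma AE_iff_nul: "(AE y in M. P y) \<longleftrightarrow> nul {y. \<not> P y}"
  unfolding nul_def eventually_ae_filter by auto

lemma nul_iff_lebesgue: "nul B \<longleftrightarrow> B \<in> null_sets lebesgue"
proof
  assume "nul B"
  then show "B \<in> null_sets lebesgue"
    unfolding nul_def null_sets_M using null_sets_completionI null_sets_completion_subset by blast
next
  assume "B \<in> null_sets lebesgue"
  then show "nul B"
    unfolding nul_def null_sets_M using null_sets_completion_iff2 by blast
qed

lemma nul_singleton: "nul {x}"
  unfolding nul_iff_lebesgue by simp

text \<open>If a Borel null set \<open>N\<close> covers \<open>B - F\<close>, then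
  \<open>E - F - N\<close> is a measurable subset of \<open>E - B\<close>, hence null.\<close>

lemma ex_env:
  "\<exists>E \<in> sets M. B \<subseteq> E \<and> (\<forall>F \<in> sets M. nul (B - F) \<longrightarrow> nul (E - F))"
proof -
  obtain E where E: "measurable_envelope M B E"
    using measurable_envelopeI_countable_cover[of B "\<lambda>_. UNIV" M] sets.top[of M]
    by (auto simp: emeasure_eq_measure)
  have "nul (E - F)" if F: "F \<in> sets M" "nul (B - F)" for F
  proof -
    obtain N where N: "N \<in> null_sets M" "B - F \<subseteq> N"
      using F unfolding nul_def by blast
    have "E - F - N \<in> sets M"
      using measurable_envelopeD(2)[OF E] F N by auto
    moreover have "emeasure M (E - F - N) = 0"
      using calculation N by (intro measurable_envelopeD1[OF E]) auto
    ultimately have "nul (E - F - N)"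
      by (auto simp: nul_iff_null_sets)
    moreover have "nul N"
      using N nul_def by blast
    ultimately show ?thesis
      by (rule nul_subset[OF nul_Un]) blast
  qed
  then show ?thesis
    using measurable_envelopeD(1,2)[OF E] by blast
qed

definition env :: "real set \<Rightarrow> real set" where
  "env B = (SOME E. E \<in> sets M \<and> B \<subseteq> E \<and> (\<forall>F \<in> sets M. nul (B - F) \<longrightarrow> nul (E - F)))"

lemma env_sets [measurable, simp]: "env B \<in> sets M"
  and env_superset: "B \<subseteq> env B"
  and env_min: "F \<in> sets M \<Longrightarrow> nul (B - F) \<Longrightarrow> nul (env B - F)"
proof -
  have "env B \<in> sets M \<and> B \<subseteq> env B \<and> (\<forall>F \<in> sets M. nul (B - F) \<longrightarrow> nul (env B - F))"
    unfolding env_def by (rule someI_ex) (use ex_env[of B] in \<open>simp only: Bex_def\<close>)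
  then show "env B \<in> sets M" "B \<subseteq> env B" "F \<in> sets M \<Longrightarrow> nul (B - F) \<Longrightarrow> nul (env B - F)"
    by simp_all
qed

lemma env_mono: "nul (B - C) \<Longrightarrow> nul (env B - env C)"
  using env_superset[of C] by (intro env_min env_sets) (erule nul_subset, blast)

text \<open>If \<open>B\<close> is null inside \<open>E\<close>, the complement of \<open>E\<close>
  almost covers \<open>B\<close>, and minimality pushes the envelope out of
  \<open>E\<close>.\<close>

lemma nul_env_Int_iff: "E \<in> sets M \<Longrightarrow> nul (env B \<inter> E) \<longleftrightarrow> nul (B \<inter> E)"
proof
  assume E: "E \<in> sets M" and B: "nul (B \<inter> E)"
  have "nul (env B - (UNIV - E))"
  proof (rule env_min)
    show "UNIV - E \<in> sets M"
      using sets.compl_sets[OF E] by simp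
    show "nul (B - (UNIV - E))"
      by (rule nul_subset[OF B]) blast
  qed
  then show "nul (env B \<inter> E)"
    by (rule nul_subset) blast
next
  assume "nul (env B \<inter> E)"
  then show "nul (B \<inter> E)"
    by (rule nul_subset) (use env_superset[of B] in blast)
qed

lemma env_UN:
  assumes "countable I" "nul (B - (\<Union>i\<in>I. C i))"
  shows "nul (env B - (\<Union>i\<in>I. env (C i)))"
proof (rule env_min)
  show "(\<Union>i\<in>I. env (C i)) \<in> sets M"
    using assms(1) by (intro sets.countable_UN') auto
  show "nul (B - (\<Union>i\<in>I. env (C i)))"
    by (rule nul_subset[OF assms(2)]) (use env_superset in blast)
qed

lemma env_mono_Int:
  assumes "E \<in> sets M" "nul (B \<inter> E - C)"
  shows "nul (env B \<inter> E - env C)"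
proof -
  have "nul (env B - (env C \<union> (UNIV - E)))"
  proof (rule env_min)
    show "env C \<union> (UNIV - E) \<in> sets M"
      using assms(1) sets.compl_sets by auto
    show "nul (B - (env C \<union> (UNIV - E)))"
      by (rule nul_subset[OF assms(2)]) (use env_superset[of C] in blast)
  qed
  then show ?thesis
    by (rule nul_subset) blast
qed

lemma measure_mono_nul:
  assumes "E \<in> sets M" "F \<in> sets M" "nul (E - F)"
  shows "measure M E \<le> measure M F"
proof -
  have "measure M E \<le> measure M (F \<union> (E - F))"
    using assms by (intro finite_measure_mono) auto
  also have "\<dots> \<le> measure M F + measure M (E - F)"
    using assms by (intro measure_Un_le) auto
  finally show ?thesis
    using assms nul_measure[of "E - F"] by auto
qed

end

subsection \<open>Ranks below the additivity of the null ideal\<close>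

text \<open>Open sets are coded by countably many bits, so a bit sequence can describe a null
  cover.\<close>

lemma (in finite_lborel) nul_subset_null_gdelta:
  assumes "nul B"
  obtains U :: "nat \<Rightarrow> real set"
  where "\<And>k. open (U k)" "B \<subseteq> (\<Inter>k. U k)" "nul (\<Inter>k. U k)"
proof -
  have B: "B \<in> null_sets lebesgue"
    using assms by (simp add: nul_iff_lebesgue)
  obtain G T where G: "gdelta G" "T \<in> null_sets lebesgue" "B \<union> T = G"
    using lebesgue_set_almost_gdelta[of B] B by (metis null_setsD2)
  have "G \<in> null_sets lebesgue"
    using B G by auto
  then have "nul G"
    by (simp add: nul_iff_lebesgue)
  from G(1) show ?thesis
  proof cases
    case (1 U)
    with that[of U] G \<open>nul G\<close> show ?thesis
      by auto
  qed
qed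

text \<open>The index \<open>f a\<close> plays the role of an ordinal below the additivity \<open>\<kappa>\<close> of the null
  ideal on \<open>A\<close>, with \<open>lt\<close> as the strict order of \<open>\<kappa>\<close>.\<close>

locale ranked = finite_lborel M for M :: "real measure" +
  fixes A :: "real set" and f :: "real \<Rightarrow> 'i" and lt :: "'i \<Rightarrow> 'i \<Rightarrow> bool"
  assumes not_nul_A: "\<not> nul A"
    and nul_not_above: "\<xi> \<in> f ` A \<Longrightarrow> nul {a \<in> A. \<not> lt \<xi> (f a)}"
    and nul_below: "\<xi> \<in> f ` A \<Longrightarrow> nul {b \<in> A. lt (f b) \<xi>}"
    and nul_UN_below: "\<xi> \<in> f ` A \<Longrightarrow> (\<And>\<eta>. nul (g \<eta>)) \<Longrightarrow> nul (A \<inter> (\<Union>\<eta>\<in>{\<eta>. lt \<eta> \<xi>}. g \<eta>))"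
begin

text \<open>The bits of \<open>x \<xi>\<close> code a null \<open>G\<^sub>\<delta>\<close> set containing all points of rank below \<open>\<xi>\<close>.
  If no bit split \<open>B\<close>, this code would agree on \<open>B\<close> with a Borel function of the point,
  and Fubini's theorem would fail for the set of pairs \<open>(a, y)\<close> with \<open>y\<close> in the null set coded
  at \<open>a\<close>.\<close>

lemma ex_splitting_bits:
  "\<exists>x :: 'i \<Rightarrow> nat \<Rightarrow> bool. \<forall>B\<subseteq>A. \<not> nul B \<longrightarrow>
    (\<exists>t. \<not> nul (env {a \<in> B. x (f a) t} \<inter> env {a \<in> B. \<not> x (f a) t}))"
proof -
  obtain \<B> :: "real set set" where \<B>: "countable \<B>" "topological_basis \<B>"
    using ex_countable_basis by blast
  then have "\<B> \<noteq> {}"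
    unfolding topological_basis_def by (metis Sup_empty UNIV_not_empty open_UNIV subset_empty)
  define I where "I = from_nat_into \<B>"
  have I: "range I = \<B>"
    unfolding I_def using \<B>(1) \<open>\<B> \<noteq> {}\<close> by (rule range_from_nat_into[rotated])
  then have openI: "open (I j)" for j
    using \<B>(2) topological_basis_open by blast
  have open_eq: "(\<Union>j\<in>{j. I j \<subseteq> V}. I j) = V" if "open V" for V
  proof -
    obtain B' where "B' \<subseteq> \<B>" "\<Union>B' = V"
      using \<B>(2) \<open>open V\<close> unfolding topological_basis_def by blast
    then show ?thesis
      using I by blast
  qed
  have "\<exists>U :: nat \<Rightarrow> real set. (\<forall>k. open (U k)) \<and> {b \<in> A. lt (f b) \<xi>} \<subseteq> (\<Inter>k. U k) \<and> nul (\<Inter>k. U k)"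
    if "\<xi> \<in> f ` A" for \<xi>
  proof (rule nul_subset_null_gdelta[OF nul_below[OF that]])
    fix U :: "nat \<Rightarrow> real set"
    assume "\<And>k. open (U k)" "{b \<in> A. lt (f b) \<xi>} \<subseteq> (\<Inter>k. U k)" "nul (\<Inter>k. U k)"
    then show ?thesis
      by - (rule exI[of _ U], simp)
  qed
  then have "\<forall>\<xi>\<in>f ` A. \<exists>U :: nat \<Rightarrow> real set. (\<forall>k. open (U k)) \<and> {b \<in> A. lt (f b) \<xi>} \<subseteq> (\<Inter>k. U k) \<and> nul (\<Inter>k. U k)"
    by blast
  from bchoice[OF this] obtain U :: "'i \<Rightarrow> nat \<Rightarrow> real set" where
    U_all: "\<forall>\<xi>\<in>f ` A. (\<forall>k. open (U \<xi> k)) \<and> {b \<in> A. lt (f b) \<xi>} \<subseteq> (\<Inter>k. U \<xi> k) \<and> nul (\<Inter>k. U \<xi> k)"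
    ..
  have U: "\<And>k. open (U \<xi> k)" "{b \<in> A. lt (f b) \<xi>} \<subseteq> (\<Inter>k. U \<xi> k)" "nul (\<Inter>k. U \<xi> k)"
    if "\<xi> \<in> f ` A" for \<xi>
    using bspec[OF U_all that] by simp_all
  \<comment> \<open>Bit \<open>t\<close> stands for a pair \<open>(k, j)\<close>. The bits recover
    \<open>U \<xi> k\<close>, an open set being the union of the basic sets it contains
    (\<open>open_eq\<close>).\<close>
  define x where "x \<xi> t \<longleftrightarrow> (case prod_decode t of (k, j) \<Rightarrow> I j \<subseteq> U \<xi> k)" for \<xi> t
  have "\<exists>t. \<not> nul (env {a \<in> B. x (f a) t} \<inter> env {a \<in> B. \<not> x (f a) t})"
    if B: "B \<subseteq> A" "\<not> nul B" for B
  proof (rule ccontr)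
    assume "\<not> ?thesis"
    then have nosplit: "nul (env {a \<in> B. x (f a) t} \<inter> env {a \<in> B. \<not> x (f a) t})" for t
      by blast
    \<comment> \<open>Without splitting, \<open>E t\<close> decides bit \<open>t\<close> at all
      points of \<open>B\<close> outside the null set \<open>N\<close>.\<close>
    define E where "E t = env {a \<in> B. x (f a) t}" for t
    have [measurable]: "E t \<in> sets M" for t
      by (simp add: E_def)
    define N where "N = (\<Union>t. {a \<in> B. \<not> x (f a) t} \<inter> E t)"
    have "nul N"
      unfolding N_def
    proof (rule nul_UN)
      fix t
      show "nul ({a \<in> B. \<not> x (f a) t} \<inter> E t)"
        by (rule nul_subset[OF nosplit[of t]])
          (use env_superset[of "{a \<in> B. \<not> x (f a) t}"] in \<open>auto simp: E_def\<close>)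
    qed simp
    have E_iff: "a \<in> E t \<longleftrightarrow> x (f a) t" if "a \<in> B - N" for a t
      using that env_superset[of "{a \<in> B. x (f a) t}"] by (auto simp: N_def E_def)
    define H where "H = (\<Inter>k. \<Union>j. E (prod_encode (k, j)) \<times> I j)"
    have I_sets [measurable]: "I j \<in> sets M" for j
      using openI by (simp add: sets_M)
    have H [measurable]: "H \<in> sets (M \<Otimes>\<^sub>M M)"
      unfolding H_def by measurable
    interpret pair_sigma_finite M M ..
    have H_eq: "Pair a -` H = (\<Inter>k. U (f a) k)" if "a \<in> B - N" for a
    proof -
      have "Pair a -` H = (\<Inter>k. \<Union>j\<in>{j. a \<in> E (prod_encode (k, j))}. I j)"
        by (auto simp: H_def)
      also have "\<dots> = (\<Inter>k. \<Union>j\<in>{j. I j \<subseteq> U (f a) k}. I j)"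
        using E_iff[OF that] by (simp add: x_def)
      also have "\<dots> = (\<Inter>k. U (f a) k)"
        using that B U(1) by (subst open_eq) auto
      finally show ?thesis .
    qed
    \<comment> \<open>Sections of \<open>H\<close> outside \<open>B - N\<close> may have positive
      measure; restricting to \<open>W\<close> makes all remaining vertical sections null.\<close>
    define W where "W = {a. emeasure M (Pair a -` H) = 0}"
    have "{a \<in> space M. emeasure M (Pair a -` H) = 0} \<in> sets M"
      using measurable_emeasure_Pair1[OF H] by measurable
    then have W [measurable]: "W \<in> sets M"
      by (simp add: W_def)
    have BW: "B - N \<subseteq> W"
    proof
      fix a assume a: "a \<in> B - N"
      then have "nul (Pair a -` H)"
        using U(3)[of "f a"] B by (auto simp: H_eq)
      then show "a \<in> W"
        using sets_Pair1[OF H, of a] by (simp add: W_def nul_iff_null_sets null_sets_def)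
    qed
    have "AE a in M. AE y in M. \<not> (a \<in> W \<and> (a, y) \<in> H)"
    proof (rule AE_I2)
      fix a
      show "AE y in M. \<not> (a \<in> W \<and> (a, y) \<in> H)"
      proof (cases "a \<in> W")
        case True
        then have "Pair a -` H \<in> null_sets M"
          using sets_Pair1[OF H, of a] by (auto simp: W_def null_sets_def)
        then have "AE y in M. y \<notin> Pair a -` H"
          by (rule AE_not_in)
        then show ?thesis
          by eventually_elim auto
      qed simp
    qed
    then have "AE y in M. AE a in M. \<not> (a \<in> W \<and> (a, y) \<in> H)"
      by (subst (asm) AE_commute) auto
    then have "nul {y. \<not> (AE a in M. \<not> (a \<in> W \<and> (a, y) \<in> H))}"
      by (simp only: AE_iff_nul)
    \<comment> \<open>As \<open>A\<close> is not null, some \<open>y \<in> A\<close> has a null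
      horizontal section; but this section contains every \<open>a \<in> B - N\<close> of rank above
      \<open>f y\<close>, hence almost all of \<open>B\<close>.\<close>
    then have "\<not> A \<subseteq> {y. \<not> (AE a in M. \<not> (a \<in> W \<and> (a, y) \<in> H))}"
      using not_nul_A nul_subset by blast
    then obtain y where "y \<in> A" and y: "AE a in M. \<not> (a \<in> W \<and> (a, y) \<in> H)"
      by blast
    from y have y: "nul {a. a \<in> W \<and> (a, y) \<in> H}"
      by (simp add: AE_iff_nul)
    have "B \<subseteq> N \<union> {a \<in> A. \<not> lt (f y) (f a)} \<union> {a. a \<in> W \<and> (a, y) \<in> H}"
    proof
      fix a assume a: "a \<in> B"
      show "a \<in> N \<union> {a \<in> A. \<not> lt (f y) (f a)} \<union> {a. a \<in> W \<and> (a, y) \<in> H}"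
      proof (cases "a \<in> N \<or> \<not> lt (f y) (f a)")
        case False
        then have "y \<in> Pair a -` H"
          using a B \<open>y \<in> A\<close> U(2)[of "f a"] by (subst H_eq) auto
        then show ?thesis
          using BW a False by auto
      qed (use a B in auto)
    qed
    moreover have "nul (N \<union> {a \<in> A. \<not> lt (f y) (f a)} \<union> {a. a \<in> W \<and> (a, y) \<in> H})"
      using \<open>nul N\<close> y \<open>y \<in> A\<close> by (intro nul_Un nul_not_above) auto
    ultimately show False
      using B(2) nul_subset by blast
  qed
  then show ?thesis
    by (intro exI[of _ x] allI impI)
qed

end

section \<open>Counting colourings\<close>

lemma card_less_if_not_inj:
  assumes "finite Q" "R \<subseteq> g ` Q" "s \<in> Q" "t \<in> Q" "s \<noteq> t" "g s = g t"
  shows "card R < card Q"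
proof -
  have "g ` Q \<subseteq> g ` (Q - {t})"
    using assms by (smt (verit) Diff_iff image_iff singletonD subsetI)
  then have "card R \<le> card (Q - {t})"
    using assms(1,2) by (meson card_mono card_image_le finite_Diff finite_imageI order_trans)
  then show ?thesis
    using assms by (metis card_Diff1_less order_le_less_trans)
qed

text \<open>Either alternative leaves only the points of \<open>L - Q\<close> free. The factor
  \<open>2 ^ K\<close> on the left avoids division in the naturals.\<close>

lemma card_monochromatic_colourings:
  assumes "finite L" "Q \<subseteq> L" "K \<le> card Q"
  shows "card {\<pi> \<in> Pow L. Q \<subseteq> \<pi> \<or> Q \<inter> \<pi> = {}} * 2 ^ K \<le> 2 * 2 ^ card L"
proof -
  have "{\<pi> \<in> Pow L. Q \<subseteq> \<pi> \<or> Q \<inter> \<pi> = {}} \<subseteq> (\<union>) Q ` Pow (L - Q) \<union> Pow (L - Q)"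
  proof
    fix \<pi> assume \<pi>: "\<pi> \<in> {\<pi> \<in> Pow L. Q \<subseteq> \<pi> \<or> Q \<inter> \<pi> = {}}"
    show "\<pi> \<in> (\<union>) Q ` Pow (L - Q) \<union> Pow (L - Q)"
    proof (cases "Q \<subseteq> \<pi>")
      case True
      then have "\<pi> = Q \<union> (\<pi> - Q)" "\<pi> - Q \<in> Pow (L - Q)"
        using \<pi> by auto
      then show ?thesis
        by blast
    qed (use \<pi> in auto)
  qed
  then have "card {\<pi> \<in> Pow L. Q \<subseteq> \<pi> \<or> Q \<inter> \<pi> = {}} \<le> card ((\<union>) Q ` Pow (L - Q) \<union> Pow (L - Q))"
    using assms by (intro card_mono) auto
  also have "\<dots> \<le> card (Pow (L - Q)) + card (Pow (L - Q))"
    using assms by (meson add_mono card_Un_le card_image_le finite_Diff finite_Pow_iff order_refl order_trans)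
  also have "\<dots> = 2 * 2 ^ (card L - card Q)"
    using assms by (simp add: card_Pow card_Diff_subset finite_subset)
  finally have "card {\<pi> \<in> Pow L. Q \<subseteq> \<pi> \<or> Q \<inter> \<pi> = {}} * 2 ^ K
      \<le> 2 * 2 ^ (card L - card Q) * 2 ^ card Q"
    using assms by (intro mult_mono) auto
  also have "\<dots> = 2 * 2 ^ card L"
    using assms by (simp add: card_mono flip: power_add)
  finally show ?thesis .
qed

text \<open>Integrates the number of sets \<open>X p\<close> containing a point.\<close>

lemma (in finite_measure) sum_measure_le_multiplicity:
  assumes "finite P" "\<And>p. p \<in> P \<Longrightarrow> X p \<in> sets M"
    and "\<And>y. y \<in> space M \<Longrightarrow> real (card {p \<in> P. y \<in> X p}) \<le> c"
  shows "(\<Sum>p\<in>P. measure M (X p)) \<le> c * measure M (space M)"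
proof -
  have "(\<Sum>p\<in>P. measure M (X p)) = (\<Sum>p\<in>P. \<integral>y. indicator (X p) y \<partial>M)"
    using assms sets.sets_into_space by (intro sum.cong) (auto simp: Int_absorb2)
  also have "\<dots> = (\<integral>y. (\<Sum>p\<in>P. indicator (X p) y) \<partial>M)"
    using assms by (intro Bochner_Integration.integral_sum[symmetric])
      (auto simp: emeasure_eq_measure)
  also have "\<dots> \<le> (\<integral>y. c \<partial>M)"
  proof (rule integral_mono)
    fix y assume "y \<in> space M"
    then show "(\<Sum>p\<in>P. indicator (X p) y :: real) \<le> c"
      using assms(1,3) by (simp add: indicator_def sum.If_cases Int_def)
  qed (use assms in \<open>auto simp: emeasure_eq_measure\<close>)
  finally show ?thesis
    by (simp add: mult.commute)
qed

section \<open>Cells accumulating at a point\<close>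

locale coded = ranked +
  fixes x :: "'a \<Rightarrow> nat \<Rightarrow> bool"
  assumes splits: "B \<subseteq> A \<Longrightarrow> \<not> nul B \<Longrightarrow>
    \<exists>t. \<not> nul (env {a \<in> B. x (f a) t} \<inter> env {a \<in> B. \<not> x (f a) t})"
begin

text \<open>A bit prefix is kept as the set of positions of its ones, so prefixes of length
  \<open>i\<close> range over the finite set \<open>Pow {..<i}\<close>.\<close>

definition trace where "trace i \<xi> = {t. t < i \<and> x \<xi> t}"

definition cell where "cell B i \<tau> = {a \<in> B. trace i (f a) = \<tau>}"

text \<open>Cells of one length are disjoint, but their envelopes can overlap; the size of this set
  measures how finely \<open>B\<close> is split at \<open>y\<close>.\<close>

definition traces_at where
  "traces_at B i y = {\<tau> \<in> Pow {..<i}. y \<in> env (cell B i \<tau>)}"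

lemma finite_traces_at [simp]: "finite (traces_at B i y)"
  unfolding traces_at_def by simp

text \<open>Only finitely many values of \<open>traces_at B i\<close> occur, each cut out by
  finitely many envelopes; hence \<open>P\<close> is arbitrary.\<close>

lemma traces_at_sets [measurable]: "{y. P (traces_at B i y)} \<in> sets M"
proof -
  have "{y. P (traces_at B i y)} =
      (\<Union>T\<in>{T \<in> Pow (Pow {..<i}). P T}. \<Inter>\<tau>\<in>Pow {..<i}.
        if \<tau> \<in> T then env (cell B i \<tau>) else space M - env (cell B i \<tau>))" (is "_ = ?R")
  proof (intro set_eqI iffI)
    fix y assume "y \<in> {y. P (traces_at B i y)}"
    then show "y \<in> ?R"
      by (intro UN_I[of "traces_at B i y"]) (auto simp: traces_at_def)
  next
    fix y assume "y \<in> ?R"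
    then obtain T where "T \<in> {T \<in> Pow (Pow {..<i}). P T}"
      and y: "y \<in> (\<Inter>\<tau>\<in>Pow {..<i}. if \<tau> \<in> T then env (cell B i \<tau>) else space M - env (cell B i \<tau>))"
      by (rule UN_E)
    then have T: "T \<subseteq> Pow {..<i}" "P T"
      by simp_all
    have "y \<in> env (cell B i \<tau>) \<longleftrightarrow> \<tau> \<in> T" if "\<tau> \<in> Pow {..<i}" for \<tau>
      using INT_D[OF y that] by (simp split: if_splits)
    then have "traces_at B i y = T"
      using T(1) unfolding traces_at_def by blast
    then show "y \<in> {y. P (traces_at B i y)}"
      using T(2) by simp
  qed
  also have "?R \<in> sets M"
  proof (intro sets.finite_UN sets.finite_INT)
    show "(if \<tau> \<in> T then env (cell B i \<tau>) else space M - env (cell B i \<tau>)) \<in> sets M" for T \<tau>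
      by (cases "\<tau> \<in> T") (simp_all add: sets.compl_sets del: space_M)
  qed auto
  finally show ?thesis .
qed

lemma traces_at_sets_Collect_conj [measurable]: "E \<in> sets M \<Longrightarrow> {y \<in> E. P (traces_at B i y)} \<in> sets M"
proof -
  assume "E \<in> sets M"
  then have "E \<inter> {y. P (traces_at B i y)} \<in> sets M"
    by (intro sets.Int traces_at_sets)
  then show ?thesis
    by (simp add: Int_def)
qed

lemma env_cells:
  assumes "C \<subseteq> B" "\<And>a. a \<in> C \<Longrightarrow> trace i (f a) \<in> T"
  shows "nul (env C - {y. \<exists>\<tau>\<in>T. \<tau> \<in> traces_at B i y})"
proof -
  have "C \<subseteq> (\<Union>\<tau>\<in>T \<inter> Pow {..<i}. cell B i \<tau>)"
    using assms by (auto simp: cell_def trace_def)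
  then have "C - (\<Union>\<tau>\<in>T \<inter> Pow {..<i}. cell B i \<tau>) = {}"
    by blast
  then have "nul (C - (\<Union>\<tau>\<in>T \<inter> Pow {..<i}. cell B i \<tau>))"
    by (simp only: nul_empty)
  moreover have "countable (T \<inter> Pow {..<i})"
    by (intro countable_finite) auto
  ultimately have "nul (env C - (\<Union>\<tau>\<in>T \<inter> Pow {..<i}. env (cell B i \<tau>)))"
    by (intro env_UN)
  then show ?thesis
    by (rule nul_subset) (auto simp: traces_at_def)
qed

lemma trace_Int: "j \<le> i \<Longrightarrow> trace i \<xi> \<inter> {..<j} = trace j \<xi>"
  by (auto simp: trace_def)

text \<open>A cell of length \<open>j\<close> is a finite union of cells of length \<open>i\<close>,
  whose envelopes almost cover its own. So the number of traces almost nowhere decreases.\<close>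

lemma traces_at_refine:
  assumes "j \<le> i"
  shows "nul {y. \<not> traces_at B j y \<subseteq> (\<lambda>\<tau>. \<tau> \<inter> {..<j}) ` traces_at B i y}"
proof -
  have "nul (\<Union>\<sigma>\<in>Pow {..<j}. env (cell B j \<sigma>) - {y. \<exists>\<tau>\<in>{\<tau>. \<tau> \<inter> {..<j} = \<sigma>}. \<tau> \<in> traces_at B i y})"
    using assms by (intro nul_UN env_cells countable_finite) (auto simp: cell_def trace_Int)
  then show ?thesis
    by (rule nul_subset) (auto simp: traces_at_def)
qed

text \<open>Where the count reaches \<open>K\<close> but never exceeds it, no cell can split
  further; by \<open>splits\<close> such points form a null set.\<close>

lemma nul_few_traces:
  assumes B: "B \<subseteq> A"
  shows "nul {y \<in> env B. \<forall>i. card (traces_at B i y) < K}"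
proof (induction K)
  case (Suc K)
  have Int_eq: "{y \<in> env B. \<forall>i. card (traces_at B i y) < k} =
      (\<Inter>i. {y \<in> env B. card (traces_at B i y) < k})" for k
    by auto
  show ?case
  proof (cases "K = 0")
    case True
    have "cell B 0 {} = B"
      by (auto simp: cell_def trace_def)
    then have "traces_at B 0 y = {{}}" if "y \<in> env B" for y
      using that by (auto simp: traces_at_def)
    then have "{y \<in> env B. \<forall>i. card (traces_at B i y) < Suc K} = {}"
      using True by fastforce
    then show ?thesis
      by (simp only: nul_empty)
  next
    case False
    define Z where "Z k = {y \<in> env B. \<forall>i. card (traces_at B i y) < k}" for k
    define Y where "Y i \<tau> = {y \<in> Z (Suc K). K \<le> card (traces_at B i y) \<and> \<tau> \<in> traces_at B i y}"
      for i \<tau>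
    have [measurable]: "Z k \<in> sets M" for k
      unfolding Z_def Int_eq by (intro sets.countable_INT) auto
    have Y_sets: "Y i \<tau> \<in> sets M" for i \<tau>
      unfolding Y_def by measurable
    have "nul (Y i \<tau>)" for i \<tau>
    proof (rule ccontr)
      assume Y: "\<not> nul (Y i \<tau>)"
      define B' where "B' = cell B i \<tau> \<inter> Y i \<tau>"
      have "Y i \<tau> \<subseteq> env (cell B i \<tau>) \<inter> Y i \<tau>"
        by (auto simp: Y_def traces_at_def)
      then have "\<not> nul B'"
        using Y Y_sets[of i \<tau>] nul_subset unfolding B'_def by (metis nul_env_Int_iff)
      moreover have "B' \<subseteq> B"
        by (auto simp: B'_def cell_def)
      ultimately obtain t where t: "\<not> nul (env {a \<in> B'. x (f a) t} \<inter> env {a \<in> B'. \<not> x (f a) t})"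
        using splits[of B'] B by blast
      \<comment> \<open>Prefixes of length \<open>n\<close> refine those of length \<open>i\<close>
        and include bit \<open>t\<close>.\<close>
      define n where "n = max i (Suc t)"
      define T where "T b = {\<sigma>. \<sigma> \<inter> {..<i} = \<tau> \<and> (t \<in> \<sigma> \<longleftrightarrow> b)}" for b
      have 1: "nul (env {a \<in> B'. x (f a) t} - {y. \<exists>\<sigma>\<in>T True. \<sigma> \<in> traces_at B n y})"
        using \<open>B' \<subseteq> B\<close>
        by (intro env_cells) (auto simp: T_def B'_def cell_def n_def trace_def)
      have 2: "nul (env {a \<in> B'. \<not> x (f a) t} - {y. \<exists>\<sigma>\<in>T False. \<sigma> \<in> traces_at B n y})"
        using \<open>B' \<subseteq> B\<close>
        by (intro env_cells) (auto simp: T_def B'_def cell_def n_def trace_def)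
      have 3: "nul (env {a \<in> B'. x (f a) t} - Y i \<tau>)"
      proof (rule env_min[OF Y_sets])
        have "{a \<in> B'. x (f a) t} - Y i \<tau> = {}"
          by (auto simp: B'_def)
        then show "nul ({a \<in> B'. x (f a) t} - Y i \<tau>)"
          by (simp only: nul_empty)
      qed
      have 4: "nul {y. \<not> traces_at B i y \<subseteq> (\<lambda>\<tau>. \<tau> \<inter> {..<i}) ` traces_at B n y}"
        by (rule traces_at_refine) (simp add: n_def)
      \<comment> \<open>Some \<open>y\<close> survives the removal of all null exceptions. There
        \<open>\<tau>\<close> has extensions with both values of bit \<open>t\<close>, so the count
        rises from \<open>i\<close> to \<open>n\<close>.\<close>
      have "\<not> nul (env {a \<in> B'. x (f a) t} \<inter> env {a \<in> B'. \<not> x (f a) t} -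
        ((env {a \<in> B'. x (f a) t} - {y. \<exists>\<sigma>\<in>T True. \<sigma> \<in> traces_at B n y}) \<union>
         (env {a \<in> B'. \<not> x (f a) t} - {y. \<exists>\<sigma>\<in>T False. \<sigma> \<in> traces_at B n y}) \<union>
         (env {a \<in> B'. x (f a) t} - Y i \<tau>) \<union>
         {y. \<not> traces_at B i y \<subseteq> (\<lambda>\<tau>. \<tau> \<inter> {..<i}) ` traces_at B n y}))" (is "\<not> nul (?E - ?N)")
      proof
        assume "nul (?E - ?N)"
        from nul_Un[OF this nul_Un[OF nul_Un[OF nul_Un[OF 1 2] 3] 4]] show False
          using t nul_subset by blast
      qed
      then have "?E - ?N \<noteq> {}"
        by (metis nul_empty)
      then obtain y where y: "y \<in> ?E - ?N"
        by blast
      then obtain \<sigma> \<sigma>' where \<sigma>: "\<sigma> \<in> T True" "\<sigma> \<in> traces_at B n y" "\<sigma>' \<in> T False" "\<sigma>' \<in> traces_at B n y"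
        by blast
      have "y \<in> Y i \<tau>"
        using y by blast
      have refine: "traces_at B i y \<subseteq> (\<lambda>\<tau>. \<tau> \<inter> {..<i}) ` traces_at B n y"
        using y by blast
      have "\<sigma> \<noteq> \<sigma>'" "\<sigma> \<inter> {..<i} = \<sigma>' \<inter> {..<i}"
        using \<sigma>(1,3) by (auto simp: T_def)
      then have "card (traces_at B i y) < card (traces_at B n y)"
        by (rule card_less_if_not_inj[OF finite_traces_at refine \<sigma>(2,4)])
      moreover have "K \<le> card (traces_at B i y)" "card (traces_at B n y) < Suc K"
        using \<open>y \<in> Y i \<tau>\<close> by (auto simp: Y_def Z_def)
      ultimately show False
        by simp
    qed
    then have "nul (\<Union>\<tau>\<in>Pow {..<i}. Y i \<tau>)" for i
      by (intro nul_UN countable_finite) auto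
    then have "nul (\<Union>i. \<Union>\<tau>\<in>Pow {..<i}. Y i \<tau>)"
      by (rule nul_UN[rotated]) simp
    then have "nul (Z K \<union> (\<Union>i. \<Union>\<tau>\<in>Pow {..<i}. Y i \<tau>))"
      using Suc.IH by (intro nul_Un) (simp_all add: Z_def)
    moreover have "Z (Suc K) \<subseteq> Z K \<union> (\<Union>i. \<Union>\<tau>\<in>Pow {..<i}. Y i \<tau>)"
    proof
      fix y assume y: "y \<in> Z (Suc K)"
      show "y \<in> Z K \<union> (\<Union>i. \<Union>\<tau>\<in>Pow {..<i}. Y i \<tau>)"
      proof (cases "y \<in> Z K")
        case False
        then obtain i where i: "K \<le> card (traces_at B i y)"
          using y by (auto simp: Z_def not_less)
        with \<open>K \<noteq> 0\<close> have "traces_at B i y \<noteq> {}"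
          by auto
        then obtain \<tau> where "\<tau> \<in> traces_at B i y"
          by blast
        then have "y \<in> Y i \<tau>" "\<tau> \<in> Pow {..<i}"
          using i y by (auto simp: Y_def traces_at_def)
        then show ?thesis
          by blast
      qed simp
    qed
    ultimately have "nul (Z (Suc K))"
      by (rule nul_subset)
    then show ?thesis
      by (simp add: Z_def)
  qed
qed simp

end

subsection \<open>Almost full partitions\<close>

context coded
begin

lemma eventually_many_traces:
  assumes "B \<subseteq> A" "\<epsilon> > 0"
  shows "\<forall>\<^sub>F i in sequentially. measure M {y \<in> env B. card (traces_at B i y) < K} < \<epsilon>"
proof -
  define V where "V i = {y \<in> env B. card (traces_at B i y) < K}" for i
  \<comment> \<open>\<open>V i\<close> decreases only up to null sets; the intersections
    \<open>V' i\<close> decrease outright, as continuity from above requires.\<close>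
  define V' where "V' i = (\<Inter>j\<in>{..i}. V j)" for i
  have V [measurable]: "V i \<in> sets M" for i
    unfolding V_def by measurable
  have V' [measurable]: "V' i \<in> sets M" for i
    unfolding V'_def by (intro sets.finite_INT) auto
  have "(\<lambda>i. measure M (V' i)) \<longlonglongrightarrow> measure M (\<Inter>i. V' i)"
    by (intro finite_Lim_measure_decseq) (auto simp: V'_def decseq_def)
  moreover have "(\<Inter>i. V' i) = {y \<in> env B. \<forall>i. card (traces_at B i y) < K}"
    by (auto simp: V'_def V_def)
  moreover have "(\<Inter>i. V' i) \<in> sets M"
    by (intro sets.countable_INT) auto
  ultimately have "(\<lambda>i. measure M (V' i)) \<longlonglongrightarrow> 0"
    using nul_few_traces[OF assms(1), of K] nul_measure[of "\<Inter>i. V' i"] by simp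
  then have "\<forall>\<^sub>F i in sequentially. measure M (V' i) < \<epsilon>"
    using assms(2) by (rule order_tendstoD)
  moreover have "measure M (V i) \<le> measure M (V' i)" for i
  proof (rule measure_mono_nul)
    have "nul (\<Union>j\<in>{..i}. {y. \<not> traces_at B j y \<subseteq> (\<lambda>\<tau>. \<tau> \<inter> {..<j}) ` traces_at B i y})"
      by (intro nul_UN traces_at_refine) auto
    then show "nul (V i - V' i)"
    proof (rule nul_subset, safe)
      fix y assume "y \<in> V i" "y \<notin> V' i"
      then obtain j where j: "j \<le> i" "card (traces_at B i y) < card (traces_at B j y)"
        by (auto simp: V'_def V_def)
      have "\<not> traces_at B j y \<subseteq> (\<lambda>\<tau>. \<tau> \<inter> {..<j}) ` traces_at B i y"
      proof
        assume "traces_at B j y \<subseteq> (\<lambda>\<tau>. \<tau> \<inter> {..<j}) ` traces_at B i y"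
        then have "card (traces_at B j y) \<le> card (traces_at B i y)"
          by (rule surj_card_le[OF finite_traces_at])
        then show False
          using j(2) by simp
      qed
      then show "y \<in> (\<Union>j\<in>{..i}. {y. \<not> traces_at B j y \<subseteq> (\<lambda>\<tau>. \<tau> \<inter> {..<j}) ` traces_at B i y})"
        using j(1) by blast
    qed
  qed auto
  ultimately show ?thesis
    unfolding V_def by (elim eventually_mono) (meson order_le_less_trans)
qed

text \<open>A random set of cells works: where at least \<open>K\<close> cells accumulate, it contains all or
  none of them with probability at most \<open>2 / 2 ^ K\<close>.\<close>

lemma ex_approx_split:
  assumes "finite J" "\<And>j. j \<in> J \<Longrightarrow> B j \<subseteq> A" "\<epsilon> > 0"
  shows "\<exists>S. \<forall>j\<in>J. measure M (env (B j) - env {a \<in> B j. f a \<in> S}) < \<epsilon> \<and>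
    measure M (env (B j) - env {a \<in> B j. f a \<notin> S}) < \<epsilon>"
proof -
  \<comment> \<open>\<open>c * (1 / 2) ^ K\<close> bounds the average over all colourings
    \<open>\<pi>\<close> of the total measure of the sets \<open>fail j \<pi>\<close>.\<close>
  define c where "c = real (card J) * 2 * measure M (space M)"
  have "(\<lambda>K. c * (1 / 2) ^ K) \<longlonglongrightarrow> c * 0"
    by (intro tendsto_intros) auto
  then have "\<forall>\<^sub>F K in sequentially. c * (1 / 2) ^ K < \<epsilon> / 2"
    using assms(3) by (intro order_tendstoD) auto
  then obtain K where K: "c * (1 / 2) ^ K < \<epsilon> / 2"
    by (meson eventually_happens' sequentially_bot)
  have "\<forall>\<^sub>F i in sequentially. \<forall>j\<in>J. measure M {y \<in> env (B j). card (traces_at (B j) i y) < K} < \<epsilon> / 2"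
    using assms by (intro eventually_ball_finite ballI eventually_many_traces) auto
  from eventually_happens'[OF sequentially_bot this]
  obtain i where i: "\<forall>j\<in>J. measure M {y \<in> env (B j). card (traces_at (B j) i y) < K} < \<epsilon> / 2" ..
  define L where "L = Pow {..<i}"
  define fail where "fail j \<pi> = {y. K \<le> card (traces_at (B j) i y) \<and>
    (traces_at (B j) i y \<subseteq> \<pi> \<or> traces_at (B j) i y \<inter> \<pi> = {})}" for j \<pi>
  have [measurable]: "fail j \<pi> \<in> sets M" for j \<pi>
    unfolding fail_def by (rule traces_at_sets)
  have "finite L"
    by (simp add: L_def)
  have fail_le: "(\<Sum>\<pi>\<in>Pow L. measure M (fail j \<pi>)) \<le> 2 * 2 ^ card L / 2 ^ K * measure M (space M)" for j
  proof (rule sum_measure_le_multiplicity)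
    fix y
    show "real (card {\<pi> \<in> Pow L. y \<in> fail j \<pi>}) \<le> 2 * 2 ^ card L / 2 ^ K"
    proof (cases "K \<le> card (traces_at (B j) i y)")
      case True
      moreover have "traces_at (B j) i y \<subseteq> L"
        by (auto simp: traces_at_def L_def)
      ultimately have "card {\<pi> \<in> Pow L. y \<in> fail j \<pi>} * 2 ^ K \<le> 2 * 2 ^ card L"
        using card_monochromatic_colourings[OF \<open>finite L\<close>, of "traces_at (B j) i y" K]
        by (simp add: fail_def)
      then have "real (card {\<pi> \<in> Pow L. y \<in> fail j \<pi>} * 2 ^ K) \<le> real (2 * 2 ^ card L)"
        by (rule of_nat_mono)
      then show ?thesis
        by (simp add: field_simps)
    qed (simp add: fail_def)
  qed (use \<open>finite L\<close> in auto)
  have "(\<Sum>\<pi>\<in>Pow L. \<Sum>j\<in>J. measure M (fail j \<pi>)) = (\<Sum>j\<in>J. \<Sum>\<pi>\<in>Pow L. measure M (fail j \<pi>))"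
    by (rule sum.swap)
  also have "\<dots> \<le> (\<Sum>j\<in>J. 2 * 2 ^ card L / 2 ^ K * measure M (space M))"
    by (intro sum_mono fail_le)
  also have "\<dots> = 2 ^ card L * (c * (1 / 2) ^ K)"
    by (simp add: c_def power_divide)
  also have "\<dots> < 2 ^ card L * (\<epsilon> / 2)"
    using K by simp
  also have "\<dots> = (\<Sum>\<pi>\<in>Pow L. \<epsilon> / 2)"
    using \<open>finite L\<close> by (simp add: card_Pow)
  finally obtain \<pi> where \<pi>: "\<pi> \<in> Pow L" "(\<Sum>j\<in>J. measure M (fail j \<pi>)) < \<epsilon> / 2"
    by (meson not_less sum_mono)
  \<comment> \<open>Kept general in \<open>\<rho>\<close> to serve both \<open>\<pi>\<close> and its
    complement \<open>L - \<pi>\<close>.\<close>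
  have approx: "measure M (env (B j) - env {a \<in> B j. trace i (f a) \<in> \<rho>}) < \<epsilon>"
    if j: "j \<in> J" and \<rho>: "\<And>y. K \<le> card (traces_at (B j) i y) \<Longrightarrow> traces_at (B j) i y \<inter> \<rho> = {} \<Longrightarrow> y \<in> fail j \<pi>"
    for j \<rho>
  proof -
    define C where "C = {a \<in> B j. trace i (f a) \<in> \<rho>}"
    define few where "few = {y \<in> env (B j). card (traces_at (B j) i y) < K}"
    have [measurable]: "few \<in> sets M"
      unfolding few_def by measurable
    have "measure M (env (B j) - env C) \<le> measure M (few \<union> fail j \<pi>)"
    proof (rule measure_mono_nul)
      have "cell (B j) i \<tau> - C = {}" if "\<tau> \<in> \<rho>" for \<tau>
        using that by (auto simp: cell_def C_def)
      then have "nul (env (cell (B j) i \<tau>) - env C)" if "\<tau> \<in> \<rho>" for \<tau>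
        using that by (intro env_mono) (simp only: nul_empty)
      then have "nul (\<Union>\<tau>\<in>\<rho> \<inter> L. env (cell (B j) i \<tau>) - env C)"
        using \<open>finite L\<close> by (intro nul_UN) (auto intro: countable_finite)
      then show "nul (env (B j) - env C - (few \<union> fail j \<pi>))"
      proof (rule nul_subset[OF _ subsetI])
        fix y assume "y \<in> env (B j) - env C - (few \<union> fail j \<pi>)"
        then have y: "y \<in> env (B j)" "y \<notin> env C" "y \<notin> few" "y \<notin> fail j \<pi>"
          by simp_all
        then have "traces_at (B j) i y \<inter> \<rho> \<noteq> {}"
          using \<rho>[of y] by (auto simp: few_def not_less)
        then show "y \<in> (\<Union>\<tau>\<in>\<rho> \<inter> L. env (cell (B j) i \<tau>) - env C)"
          using y(2) by (auto simp: traces_at_def L_def)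
      qed
    qed auto
    also have "\<dots> \<le> measure M few + measure M (fail j \<pi>)"
      by (intro measure_Un_le) auto
    also have "measure M (fail j \<pi>) \<le> (\<Sum>j\<in>J. measure M (fail j \<pi>))"
      using assms(1) j by (intro member_le_sum) auto
    also have "measure M few + (\<Sum>j\<in>J. measure M (fail j \<pi>)) < \<epsilon> / 2 + \<epsilon> / 2"
      using bspec[OF i j] \<pi>(2) by (intro add_strict_mono) (auto simp: few_def)
    finally show ?thesis
      by (simp add: C_def)
  qed
  show ?thesis
  proof (intro exI[of _ "{\<xi>. trace i \<xi> \<in> \<pi>}"] ballI conjI)
    fix j assume j: "j \<in> J"
    show "measure M (env (B j) - env {a \<in> B j. f a \<in> {\<xi>. trace i \<xi> \<in> \<pi>}}) < \<epsilon>"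
      using approx[OF j, of \<pi>] by (simp add: fail_def)
    have "{a \<in> B j. f a \<notin> {\<xi>. trace i \<xi> \<in> \<pi>}} = {a \<in> B j. trace i (f a) \<in> L - \<pi>}"
      by (auto simp: L_def trace_def)
    moreover have "y \<in> fail j \<pi>"
      if "K \<le> card (traces_at (B j) i y)" "traces_at (B j) i y \<inter> (L - \<pi>) = {}" for y
      using that by (auto simp: fail_def L_def traces_at_def)
    ultimately show "measure M (env (B j) - env {a \<in> B j. f a \<notin> {\<xi>. trace i \<xi> \<in> \<pi>}}) < \<epsilon>"
      using approx[OF j, of "L - \<pi>"] by simp
  qed
qed

text \<open>Colour classes are split off one by one: \<open>R v\<close> remains before colour
  \<open>v\<close>, and \<open>S (R v) v\<close> receives it. Errors
  \<open>\<epsilon> / 2 ^ Suc v\<close> keep every total below \<open>\<epsilon>\<close>.\<close>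

lemma ex_approx_partition:
  assumes "finite J" "\<And>j. j \<in> J \<Longrightarrow> B j \<subseteq> A" "\<epsilon> > 0"
  shows "\<exists>p :: 'a \<Rightarrow> nat. \<forall>j\<in>J. \<forall>v. measure M (env (B j) - env {a \<in> B j. p (f a) = v}) < \<epsilon>"
proof -
  define splitting where "splitting R v S \<longleftrightarrow> (\<forall>j\<in>J.
      measure M (env {a \<in> B j. f a \<in> R} - env {a \<in> {a \<in> B j. f a \<in> R}. f a \<in> S}) < \<epsilon> / 2 ^ Suc v \<and>
      measure M (env {a \<in> B j. f a \<in> R} - env {a \<in> {a \<in> B j. f a \<in> R}. f a \<notin> S}) < \<epsilon> / 2 ^ Suc v)"
    for R S and v :: nat
  define S where "S R v = (SOME S. splitting R v S)" for R v
  have "\<exists>S. splitting R v S" for R v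
    unfolding splitting_def by (rule ex_approx_split) (use assms in auto)
  then have "splitting R v (S R v)" for R v
    unfolding S_def by (rule someI_ex)
  then have S: "measure M (env {a \<in> B j. f a \<in> R} - env {a \<in> {a \<in> B j. f a \<in> R}. f a \<in> S R v}) < \<epsilon> / 2 ^ Suc v"
    "measure M (env {a \<in> B j. f a \<in> R} - env {a \<in> {a \<in> B j. f a \<in> R}. f a \<notin> S R v}) < \<epsilon> / 2 ^ Suc v"
    if "j \<in> J" for R v j
    using that unfolding splitting_def by blast+
  define R where "R = rec_nat UNIV (\<lambda>v Q. Q - S Q v)"
  have R_0: "R 0 = UNIV" and R_Suc: "R (Suc v) = R v - S (R v) v" for v
    by (simp_all add: R_def)
  have R_mono: "R w \<subseteq> R v" if "v \<le> w" for v w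
    using that by (induction rule: dec_induct) (auto simp: R_Suc)
  \<comment> \<open>Indices never split off get colour 0, which only enlarges that class and cannot
    spoil its fullness.\<close>
  define p where "p \<xi> = (if \<exists>v. \<xi> \<in> R v \<inter> S (R v) v then LEAST v. \<xi> \<in> R v \<inter> S (R v) v else 0)" for \<xi>
  have p: "p \<xi> = v" if "\<xi> \<in> R v \<inter> S (R v) v" for \<xi> v
  proof -
    have "v = w" if "\<xi> \<in> R w \<inter> S (R w) w" for w
    proof (rule ccontr)
      assume "v \<noteq> w"
      then consider "Suc v \<le> w" | "Suc w \<le> v"
        by linarith
      then show False
        using R_mono[of "Suc v" w] R_mono[of "Suc w" v] that \<open>\<xi> \<in> R v \<inter> S (R v) v\<close>
        by cases (auto simp: R_Suc)
    qed
    then show ?thesis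
      using that unfolding p_def by (metis (no_types, lifting) LeastI)
  qed
  have diff: "measure M (env B1 - env B3) \<le> measure M (env B1 - env B2) + measure M (env B2 - env B3)"
    for B1 B2 B3
  proof -
    have "measure M (env B1 - env B3) \<le> measure M ((env B1 - env B2) \<union> (env B2 - env B3))"
      by (intro finite_measure_mono) auto
    also have "\<dots> \<le> measure M (env B1 - env B2) + measure M (env B2 - env B3)"
      by (intro measure_Un_le) auto
    finally show ?thesis .
  qed
  have R_full: "measure M (env (B j) - env {a \<in> B j. f a \<in> R v}) \<le> \<epsilon> * (1 - 1 / 2 ^ v)"
    if j: "j \<in> J" for j v
  proof (induction v)
    case (Suc v)
    have "{a \<in> B j. f a \<in> R (Suc v)} = {a \<in> {a \<in> B j. f a \<in> R v}. f a \<notin> S (R v) v}"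
      by (auto simp: R_Suc)
    then have "measure M (env (B j) - env {a \<in> B j. f a \<in> R (Suc v)}) \<le>
        \<epsilon> * (1 - 1 / 2 ^ v) + \<epsilon> / 2 ^ Suc v"
      using diff[of "B j" "{a \<in> B j. f a \<in> R (Suc v)}" "{a \<in> B j. f a \<in> R v}"] Suc S(2)[OF j, of "R v" v]
      by simp
    also have "\<dots> = \<epsilon> * (1 - 1 / 2 ^ Suc v)"
      by (simp add: field_simps)
    finally show ?case .
  qed (simp add: R_0)
  have "measure M (env (B j) - env {a \<in> B j. p (f a) = v}) < \<epsilon>" if j: "j \<in> J" for j v
  proof -
    have "measure M (env (B j) - env {a \<in> B j. p (f a) = v}) \<le>
        measure M (env (B j) - env {a \<in> {a \<in> B j. f a \<in> R v}. f a \<in> S (R v) v})"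
    proof (rule measure_mono_nul)
      have "{a \<in> {a \<in> B j. f a \<in> R v}. f a \<in> S (R v) v} - {a \<in> B j. p (f a) = v} = {}"
        using p by auto
      then have "nul (env {a \<in> {a \<in> B j. f a \<in> R v}. f a \<in> S (R v) v} - env {a \<in> B j. p (f a) = v})"
        by (intro env_mono) (simp only: nul_empty)
      then show "nul (env (B j) - env {a \<in> B j. p (f a) = v} -
          (env (B j) - env {a \<in> {a \<in> B j. f a \<in> R v}. f a \<in> S (R v) v}))"
        by (rule nul_subset) blast
    qed auto
    also have "\<dots> < \<epsilon> * (1 - 1 / 2 ^ v) + \<epsilon> / 2 ^ Suc v"
      using diff[of "B j" "{a \<in> {a \<in> B j. f a \<in> R v}. f a \<in> S (R v) v}" "{a \<in> B j. f a \<in> R v}"]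
        R_full[OF j, of v] S(1)[OF j, of "R v" v] by linarith
    also have "\<dots> < \<epsilon>"
      using assms(3) by (simp add: field_simps)
    finally show ?thesis .
  qed
  then show ?thesis
    by blast
qed

end

subsection \<open>No countable family is dense\<close>

text \<open>Encoded as a natural number so that an approximation can be compared with a
  colour.\<close>

definition dyadic_code :: "nat \<Rightarrow> real \<Rightarrow> nat" where
  "dyadic_code k y = int_encode \<lfloor>2 ^ k * y\<rfloor>"

text \<open>Borel-Cantelli: guess \<open>k\<close> is right only within an interval of length
  \<open>(1 / 2) ^ k\<close>.\<close>

lemma (in finite_lborel) nul_infinitely_often_guessed:
  "nul {y. \<exists>\<^sub>\<infinity>k. dyadic_code k y = c k}"
proof -
  define I where "I k = {real_of_int (int_decode (c k)) / 2 ^ k..(real_of_int (int_decode (c k)) + 1) / 2 ^ k}" for k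
  have len: "(real_of_int t + 1) / 2 ^ k - real_of_int t / 2 ^ k = (1 / 2) ^ k" for t and k :: nat
    by (simp add: add_divide_distrib power_divide)
  have "emeasure lborel (I k) = ennreal ((1 / 2) ^ k)" for k
    unfolding I_def using len by (subst emeasure_lborel_Icc) (simp_all add: divide_right_mono)
  then have "(\<lambda>k. measure lborel (I k)) = (\<lambda>k. (1 / 2) ^ k)" "emeasure lborel (I k) < \<infinity>" for k
    by (auto simp: measure_def)
  moreover have "summable (\<lambda>k. (1 / 2 :: real) ^ k)"
    by (simp add: summable_geometric)
  ultimately have "limsup I \<in> null_sets lborel"
    by (intro borel_cantelli_limsup1) (auto simp: I_def)
  then have "nul (limsup I)"
    unfolding nul_def null_sets_M by blast
  moreover have "{y. \<exists>\<^sub>\<infinity>k. dyadic_code k y = c k} \<subseteq> limsup I"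
  proof
    fix y assume "y \<in> {y. \<exists>\<^sub>\<infinity>k. dyadic_code k y = c k}"
    then have "\<exists>\<^sub>\<infinity>k. dyadic_code k y = c k"
      by simp
    then have "\<exists>\<^sub>\<infinity>k. y \<in> I k"
    proof (rule frequently_elim1)
      fix k assume "dyadic_code k y = c k"
      then have "int_decode (c k) = \<lfloor>2 ^ k * y\<rfloor>"
        by (metis dyadic_code_def int_encode_inverse)
      then have "real_of_int (int_decode (c k)) \<le> 2 ^ k * y" "2 ^ k * y \<le> real_of_int (int_decode (c k)) + 1"
        by linarith+
      then show "y \<in> I k"
        unfolding I_def by (simp add: divide_le_eq le_divide_eq mult.commute)
    qed
    then show "y \<in> limsup I"
      by (simp add: mem_limsup_iff cofinite_eq_sequentially)
  qed
  ultimately show ?thesis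
    by (rule nul_subset)
qed

context coded
begin

lemma no_dense_sequence:
  fixes F :: "nat \<Rightarrow> real set"
  assumes F: "\<And>n. F n \<subseteq> A"
    and dense: "\<And>D. D \<subseteq> A \<Longrightarrow> \<not> nul D \<Longrightarrow>
      \<exists>n. \<exists>E\<in>sets M. \<not> nul (F n \<inter> E) \<and> nul (F n \<inter> E - D)"
  shows False
proof -
  \<comment> \<open>The square pays for a union over at most \<open>Suc m\<close> colours and
    \<open>Suc m\<close> sets, leaving a total of \<open>(1 / 2) ^ m\<close>.\<close>
  define \<epsilon> where "\<epsilon> m = (1 / 2) ^ m / (real (Suc m))\<^sup>2" for m
  have "\<exists>p :: 'a \<Rightarrow> nat. \<forall>n\<in>{..m}. \<forall>v. measure M (env (F n) - env {a \<in> F n. p (f a) = v}) < \<epsilon> m" for m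
    by (rule ex_approx_partition) (auto simp: \<epsilon>_def F)
  then obtain X :: "nat \<Rightarrow> 'a \<Rightarrow> nat"
    where "\<forall>m. \<forall>n\<in>{..m}. \<forall>v. measure M (env (F n) - env {a \<in> F n. X m (f a) = v}) < \<epsilon> m"
    by metis
  then have X: "measure M (env (F n) - env {a \<in> F n. X m (f a) = v}) < \<epsilon> m" if "n \<le> m" for n m v
    using that by simp
  have "\<exists>a\<in>A. \<forall>\<eta>. lt \<eta> \<xi> \<longrightarrow> \<not> (\<exists>\<^sub>\<infinity>k. dyadic_code k a = X (X k \<eta>) \<xi>)" if "\<xi> \<in> f ` A" for \<xi>
  proof -
    have "nul (A \<inter> (\<Union>\<eta>\<in>{\<eta>. lt \<eta> \<xi>}. {y. \<exists>\<^sub>\<infinity>k. dyadic_code k y = X (X k \<eta>) \<xi>}))"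
      by (rule nul_UN_below[OF that]) (rule nul_infinitely_often_guessed)
    then have "\<not> A \<subseteq> A \<inter> (\<Union>\<eta>\<in>{\<eta>. lt \<eta> \<xi>}. {y. \<exists>\<^sub>\<infinity>k. dyadic_code k y = X (X k \<eta>) \<xi>})"
      using not_nul_A nul_subset by blast
    then show ?thesis
      by blast
  qed
  then obtain w where w: "\<And>\<xi> \<eta>. \<xi> \<in> f ` A \<Longrightarrow> lt \<eta> \<xi> \<Longrightarrow> \<not> (\<exists>\<^sub>\<infinity>k. dyadic_code k (w \<xi>) = X (X k \<eta>) \<xi>)"
    by metis
  \<comment> \<open>Up to null sets, the largest measurable set inside which \<open>F n\<close> is
    contained in \<open>D\<close>.\<close>
  define inner where "inner D n = space M - env (F n - D)" for D n
  have inner_sets [measurable]: "inner D n \<in> sets M" for D n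
    unfolding inner_def by (rule sets.compl_sets) simp
  have inner_subset: "F n \<inter> inner D n \<subseteq> D" for D n
    using env_superset[of "F n - D"] by (auto simp: inner_def)
  \<comment> \<open>Otherwise density puts a non-null \<open>F n \<inter> E\<close> almost inside
    \<open>?D'\<close>. Then \<open>F n - D\<close> is null on \<open>E\<close>, so
    \<open>F n \<inter> E\<close> is almost covered by \<open>inner D n\<close> and cannot lie in
    \<open>?D'\<close>.\<close>
  have nul_inner: "nul (D - (\<Union>n. F n \<inter> inner D n))" (is "nul ?D'") if "D \<subseteq> A" for D
  proof (rule ccontr)
    assume not_nul: "\<not> nul ?D'"
    have "?D' \<subseteq> A"
      using that by (rule order_trans[OF Diff_subset])
    from dense[OF this not_nul] obtain n E
      where E: "E \<in> sets M" "\<not> nul (F n \<inter> E)" "nul (F n \<inter> E - ?D')"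
      by (elim exE bexE conjE)
    have "(F n - D) \<inter> E \<subseteq> F n \<inter> E - ?D'"
      by blast
    then have "nul (env (F n - D) \<inter> E)"
      using E nul_env_Int_iff nul_subset by blast
    with E(3) have "nul ((F n \<inter> E - ?D') \<union> env (F n - D) \<inter> E)"
      by (rule nul_Un)
    moreover have "F n \<inter> E \<subseteq> (F n \<inter> E - ?D') \<union> env (F n - D) \<inter> E"
      by (auto simp: inner_def)
    ultimately show False
      using E(2) nul_subset by blast
  qed
  \<comment> \<open>\<open>V n k \<sigma> n'\<close> is the part of \<open>F n'\<close> where
    membership in \<open>D n k \<sigma>\<close> is forced; \<open>W n k g\<close> is what indices up
    to \<open>g\<close> leave undecided.\<close>
  define D where "D n k \<sigma> = {a \<in> F n. dyadic_code k (w (f a)) = \<sigma>}" for n k \<sigma>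
  define V where "V n k \<sigma> n' = F n' \<inter> inner (D n k \<sigma>) n'" for n k \<sigma> n'
  define W where "W n k g = env (F n) - (\<Union>\<sigma>\<in>{..g}. \<Union>n'\<in>{..g}. env (V n k \<sigma> n'))" for n k g
  have W_sets [measurable]: "W n k g \<in> sets M" for n k g
    unfolding W_def by (intro sets.Diff sets.finite_UN) auto
  have "nul (\<Inter>g. W n k g)" for n k
  proof -
    have "nul (\<Union>\<sigma>. D n k \<sigma> - (\<Union>n'. V n k \<sigma> n'))"
      unfolding V_def by (intro nul_UN nul_inner) (use F in \<open>auto simp: D_def\<close>)
    then have "nul (F n - (\<Union>(\<sigma>, n')\<in>UNIV. V n k \<sigma> n'))"
      by (rule nul_subset) (auto simp: D_def)
    then have "nul (env (F n) - (\<Union>p\<in>UNIV. env (case p of (\<sigma>, n') \<Rightarrow> V n k \<sigma> n')))"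
      by (intro env_UN) auto
    then show ?thesis
    proof (rule nul_subset[OF _ subsetI])
      fix y assume y: "y \<in> (\<Inter>g. W n k g)"
      have "y \<notin> env (V n k \<sigma> n')" for \<sigma> n'
        using INT_D[OF y, of "max \<sigma> n'"] by (auto simp: W_def)
      then show "y \<in> env (F n) - (\<Union>p\<in>UNIV. env (case p of (\<sigma>, n') \<Rightarrow> V n k \<sigma> n'))"
        using y by (auto simp: W_def)
    qed
  qed
  then have W_lim: "(\<lambda>g. measure M (W n k g)) \<longlonglongrightarrow> 0" for n k
  proof -
    have "(\<lambda>g. measure M (W n k g)) \<longlonglongrightarrow> measure M (\<Inter>g. W n k g)"
      by (intro finite_Lim_measure_decseq) (auto simp: W_def decseq_def)
    moreover have "(\<Inter>g. W n k g) \<in> sets M"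
      by (intro sets.countable_INT) auto
    ultimately show ?thesis
      using \<open>nul (\<Inter>g. W n k g)\<close> by (simp add: nul_measure)
  qed
  \<comment> \<open>The bound \<open>g \<ge> k\<close> ensures that an error
    \<open>(1 / 2) ^ m\<close> with \<open>m \<ge> G k\<close> is at most
    \<open>(1 / 2) ^ k\<close>.\<close>
  have "\<exists>g\<ge>k. \<forall>n\<in>{..k}. measure M (W n k g) < (1 / 2) ^ k" for k
  proof -
    have "\<forall>\<^sub>F g in sequentially. g \<ge> k \<and> (\<forall>n\<in>{..k}. measure M (W n k g) < (1 / 2) ^ k)"
      using W_lim by (intro eventually_conj eventually_ge_at_top eventually_ball_finite ballI order_tendstoD(2)[of _ 0]) auto
    from eventually_happens'[OF sequentially_bot this] show ?thesis
      by blast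
  qed
  then obtain G where G: "\<And>k. G k \<ge> k" "\<And>k n. n \<le> k \<Longrightarrow> measure M (W n k (G k)) < (1 / 2) ^ k"
    by (metis atMost_iff)
  have bounded: "\<forall>\<^sub>F k in sequentially. X k \<eta> < G k" if \<eta>: "\<eta> \<in> f ` A" for \<eta>
  proof (rule ccontr)
    assume "\<not> ?thesis"
    then have freq: "\<exists>\<^sub>\<infinity>k. G k \<le> X k \<eta>"
      by (simp add: frequently_def cofinite_eq_sequentially not_le)
    \<comment> \<open>Almost every point has rank above \<open>\<eta>\<close>, and there
      \<open>w\<close> escapes the guesses made through \<open>\<eta>\<close> from some stage
      on.\<close>
    define U where "U k\<^sub>0 = {a \<in> A. \<forall>k\<ge>k\<^sub>0. dyadic_code k (w (f a)) \<noteq> X (X k \<eta>) (f a)}" for k\<^sub>0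
    have "A - {a \<in> A. \<not> lt \<eta> (f a)} \<subseteq> (\<Union>k\<^sub>0. U k\<^sub>0)"
    proof
      fix a assume a: "a \<in> A - {a \<in> A. \<not> lt \<eta> (f a)}"
      then have "\<not> (\<exists>\<^sub>\<infinity>k. dyadic_code k (w (f a)) = X (X k \<eta>) (f a))"
        by (intro w) auto
      then obtain k\<^sub>0 where "\<forall>k\<ge>k\<^sub>0. dyadic_code k (w (f a)) \<noteq> X (X k \<eta>) (f a)"
        by (auto simp: INFM_nat_le)
      then have "a \<in> U k\<^sub>0"
        using a by (simp add: U_def)
      then show "a \<in> (\<Union>k\<^sub>0. U k\<^sub>0)"
        by blast
    qed
    then have "A \<subseteq> {a \<in> A. \<not> lt \<eta> (f a)} \<union> (\<Union>k\<^sub>0. U k\<^sub>0)"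
      by blast
    then have "\<not> nul (\<Union>k\<^sub>0. U k\<^sub>0)"
      using nul_Un[OF nul_not_above[OF \<eta>], of "\<Union>k\<^sub>0. U k\<^sub>0"] not_nul_A nul_subset by metis
    then obtain k\<^sub>0 where U: "\<not> nul (U k\<^sub>0)"
      using nul_UN[of UNIV U] by auto
    have "U k\<^sub>0 \<subseteq> A"
      by (auto simp: U_def)
    from dense[OF this U] obtain n E
      where E: "E \<in> sets M" "\<not> nul (F n \<inter> E)" "nul (F n \<inter> E - U k\<^sub>0)"
      by (elim exE bexE conjE)
    have "measure M (env (F n) \<inter> E) > 0"
      using E(1,2) nul_measure[of "env (F n) \<inter> E"] by (simp add: nul_env_Int_iff less_le)
    moreover have "(\<lambda>k. (1 / 2 :: real) ^ k) \<longlonglongrightarrow> 0"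
      by (intro LIMSEQ_realpow_zero) auto
    \<comment> \<open>Half the measure, because two errors of size \<open>(1 / 2) ^ k\<close> will
      be added.\<close>
    ultimately have "\<forall>\<^sub>F k in sequentially. (1 / 2) ^ k < measure M (env (F n) \<inter> E) / 2 \<and> k \<ge> n \<and> k \<ge> k\<^sub>0"
      by (intro eventually_conj eventually_ge_at_top order_tendstoD(2)[of _ 0]) auto
    with freq have "\<exists>\<^sub>F k in sequentially. G k \<le> X k \<eta> \<and>
        (1 / 2) ^ k < measure M (env (F n) \<inter> E) / 2 \<and> k \<ge> n \<and> k \<ge> k\<^sub>0"
      unfolding cofinite_eq_sequentially by (rule frequently_eventually_frequently)
    then obtain k where k: "G k \<le> X k \<eta>" "(1 / 2) ^ k < measure M (env (F n) \<inter> E) / 2" "k \<ge> n" "k \<ge> k\<^sub>0"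
      using frequently_ex by blast
    define m where "m = X k \<eta>"
    define lost where "lost \<sigma> n' = env (F n') - env {a \<in> F n'. X m (f a) = \<sigma>}" for \<sigma> n'
    \<comment> \<open>A point of \<open>V n k \<sigma> n'\<close> has code \<open>\<sigma>\<close>,
      so in \<open>U k\<^sub>0\<close> its colour under \<open>X m\<close> is not
      \<open>\<sigma>\<close>. Thus colour \<open>\<sigma>\<close> is null in the forced region
      inside \<open>E\<close>, and the envelope there falls into \<open>lost \<sigma> n'\<close>,
      which is small for \<open>n' \<le> m\<close>.\<close>
    have caught: "nul (env (V n k \<sigma> n') \<inter> E - lost \<sigma> n')" for \<sigma> n'
    proof -
      have "V n k \<sigma> n' \<inter> {a \<in> F n'. X m (f a) = \<sigma>} \<inter> E \<subseteq> F n \<inter> E - U k\<^sub>0"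
        using inner_subset[of n' "D n k \<sigma>"] k(4) by (auto simp: V_def D_def U_def m_def)
      then have "nul ({a \<in> F n'. X m (f a) = \<sigma>} \<inter> (inner (D n k \<sigma>) n' \<inter> E))"
        by (intro nul_subset[OF E(3)]) (auto simp: V_def)
      then have 1: "nul (env {a \<in> F n'. X m (f a) = \<sigma>} \<inter> (inner (D n k \<sigma>) n' \<inter> E))"
        using E(1) by (simp add: nul_env_Int_iff)
      have 2: "nul (env (V n k \<sigma> n') - (env (F n') \<inter> inner (D n k \<sigma>) n'))"
      proof (rule env_min)
        have "V n k \<sigma> n' - (env (F n') \<inter> inner (D n k \<sigma>) n') = {}"
          using env_superset[of "F n'"] by (auto simp: V_def)
        then show "nul (V n k \<sigma> n' - (env (F n') \<inter> inner (D n k \<sigma>) n'))"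
          by (simp only: nul_empty)
      qed auto
      show ?thesis
        by (rule nul_subset[OF nul_Un[OF 1 2]]) (auto simp: lost_def)
    qed
    have "measure M (env (F n) \<inter> E) \<le> measure M (W n k (G k) \<union> (\<Union>\<sigma>\<in>{..G k}. \<Union>n'\<in>{..G k}. lost \<sigma> n'))"
    proof (rule measure_mono_nul)
      have "nul (\<Union>\<sigma>\<in>{..G k}. \<Union>n'\<in>{..G k}. env (V n k \<sigma> n') \<inter> E - lost \<sigma> n')"
        by (intro nul_UN caught) auto
      then show "nul (env (F n) \<inter> E - (W n k (G k) \<union> (\<Union>\<sigma>\<in>{..G k}. \<Union>n'\<in>{..G k}. lost \<sigma> n')))"
        by (rule nul_subset) (auto simp: W_def)
      show "W n k (G k) \<union> (\<Union>\<sigma>\<in>{..G k}. \<Union>n'\<in>{..G k}. lost \<sigma> n') \<in> sets M"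
        by (intro sets.Un sets.finite_UN) (auto simp: lost_def)
    qed (use E(1) in auto)
    also have "\<dots> \<le> measure M (W n k (G k)) + measure M (\<Union>\<sigma>\<in>{..G k}. \<Union>n'\<in>{..G k}. lost \<sigma> n')"
      by (intro measure_Un_le sets.finite_UN) (auto simp: lost_def)
    also have "measure M (\<Union>\<sigma>\<in>{..G k}. \<Union>n'\<in>{..G k}. lost \<sigma> n') \<le>
        (\<Sum>\<sigma>\<in>{..G k}. measure M (\<Union>n'\<in>{..G k}. lost \<sigma> n'))"
      by (intro measure_UNION_le sets.finite_UN) (auto simp: lost_def)
    also have "\<dots> \<le> (\<Sum>\<sigma>\<in>{..G k}. \<Sum>n'\<in>{..G k}. measure M (lost \<sigma> n'))"
      by (intro sum_mono measure_UNION_le) (auto simp: lost_def)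
    also have "\<dots> \<le> (\<Sum>\<sigma>\<in>{..G k}. \<Sum>n'\<in>{..G k}. \<epsilon> m)"
      using X k(1) by (intro sum_mono) (auto simp: lost_def m_def intro!: less_imp_le)
    also have "\<dots> = (real (Suc (G k)))\<^sup>2 * \<epsilon> m"
      by (simp add: power2_eq_square)
    also have "\<dots> \<le> (real (Suc m))\<^sup>2 * \<epsilon> m"
      using k(1) by (intro mult_right_mono power_mono) (auto simp: m_def \<epsilon>_def)
    also have "\<dots> = (1 / 2) ^ m"
      by (simp add: \<epsilon>_def del: of_nat_Suc)
    also have "(1 / 2 :: real) ^ m \<le> (1 / 2) ^ k"
      using k(1) G(1)[of k] by (intro power_decreasing) (auto simp: m_def)
    finally have "measure M (env (F n) \<inter> E) \<le> measure M (W n k (G k)) + (1 / 2) ^ k"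
      by simp
    then show False
      using G(2)[OF k(3)] k(2) by simp
  qed
  \<comment> \<open>Points of \<open>U k\<^sub>0\<close> omit colour \<open>G k\<close> for every
    \<open>k \<ge> k\<^sub>0\<close>, while this colour is almost full in \<open>F n\<close> once
    \<open>n \<le> k\<close>.\<close>
  define U where "U k\<^sub>0 = {a \<in> A. \<forall>k\<ge>k\<^sub>0. X k (f a) < G k}" for k\<^sub>0
  have "A \<subseteq> (\<Union>k\<^sub>0. U k\<^sub>0)"
  proof
    fix a assume a: "a \<in> A"
    then obtain k\<^sub>0 where "\<forall>k\<ge>k\<^sub>0. X k (f a) < G k"
      using bounded[of "f a"] by (auto simp: eventually_sequentially)
    then have "a \<in> U k\<^sub>0"
      using a by (simp add: U_def)
    then show "a \<in> (\<Union>k\<^sub>0. U k\<^sub>0)"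
      by blast
  qed
  then have "\<not> nul (\<Union>k\<^sub>0. U k\<^sub>0)"
    using not_nul_A nul_subset by blast
  then obtain k\<^sub>0 where U: "\<not> nul (U k\<^sub>0)"
    using nul_UN[of UNIV U] by auto
  have "U k\<^sub>0 \<subseteq> A"
    by (auto simp: U_def)
  from dense[OF this U] obtain n E
    where E: "E \<in> sets M" "\<not> nul (F n \<inter> E)" "nul (F n \<inter> E - U k\<^sub>0)"
    by (elim exE bexE conjE)
  have "measure M (env (F n) \<inter> E) > 0"
    using E(1,2) nul_measure[of "env (F n) \<inter> E"] by (simp add: nul_env_Int_iff less_le)
  moreover have "(\<lambda>k. (1 / 2 :: real) ^ k) \<longlonglongrightarrow> 0"
    by (intro LIMSEQ_realpow_zero) auto
  ultimately have "\<forall>\<^sub>F k in sequentially. (1 / 2) ^ k < measure M (env (F n) \<inter> E) \<and> k \<ge> n \<and> k \<ge> k\<^sub>0"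
    by (intro eventually_conj eventually_ge_at_top order_tendstoD(2)[of _ 0]) auto
  from eventually_happens'[OF sequentially_bot this]
  obtain k where k: "(1 / 2) ^ k < measure M (env (F n) \<inter> E)" "k \<ge> n" "k \<ge> k\<^sub>0"
    by blast
  have "measure M (env (F n) \<inter> E) \<le> measure M (env (F n) - env {a \<in> F n. X k (f a) = G k})"
  proof (rule measure_mono_nul)
    have "nul ({a \<in> F n. X k (f a) = G k} \<inter> E)"
      by (rule nul_subset[OF E(3)]) (use k(3) in \<open>auto simp: U_def\<close>)
    then have "nul (env {a \<in> F n. X k (f a) = G k} \<inter> E)"
      using E(1) by (simp add: nul_env_Int_iff)
    then show "nul (env (F n) \<inter> E - (env (F n) - env {a \<in> F n. X k (f a) = G k}))"
      by (rule nul_subset) blast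
  qed (use E(1) in auto)
  also have "\<dots> < \<epsilon> k"
    using k(2) by (rule X)
  also have "\<epsilon> k \<le> (1 / 2) ^ k"
    unfolding \<epsilon>_def by (simp add: divide_le_eq mult_le_cancel_left1 del: of_nat_Suc)
  finally show False
    using k(1) by simp
qed

end

subsection \<open>Disjoint full refinements\<close>

context finite_lborel
begin

text \<open>A smallest family of null sets with non-null union provides the ranks; proper initial
  segments of its cardinal well-order are smaller, so unions over them stay null.\<close>

lemma ex_not_dense:
  includes cardinal_syntax
  fixes F :: "nat \<Rightarrow> real set"
  assumes A: "\<not> nul A"
  shows "\<exists>D\<subseteq>A. \<not> nul D \<and> (\<forall>n. \<forall>E\<in>sets M. nul (F n \<inter> E - D) \<longrightarrow> nul (F n \<inter> E))"
proof (rule ccontr)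
  assume contra: "\<not> ?thesis"
  define \<C> where "\<C> = {\<F>. (\<forall>P\<in>\<F>. nul P) \<and> \<Union>\<F> \<subseteq> A \<and> \<not> nul (\<Union>\<F>)}"
  have "(\<lambda>a. {a}) ` A \<in> \<C>"
    using A nul_singleton by (auto simp: \<C>_def)
  then have "\<exists>r\<in>card_of ` \<C>. \<forall>r'\<in>card_of ` \<C>. r \<le>o r'"
    by (intro exists_minim_Card_order) (auto intro: card_of_Card_order)
  then obtain \<F> where \<F>: "\<F> \<in> \<C>" and min: "\<And>\<G>. \<G> \<in> \<C> \<Longrightarrow> |\<F>| \<le>o |\<G>|"
    by auto
  define r where "r = |\<F>|"
  have Field_r: "Field r = \<F>" and card_r: "Card_order r" and wo: "wo_rel r"
    unfolding r_def wo_rel_def by (fact Field_card_of card_of_Card_order card_of_Well_order)+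
  define lt where "lt P Q \<longleftrightarrow> P \<in> underS r Q" for P Q
  define f where "f a = wo_rel.minim r {P \<in> \<F>. a \<in> P}" for a
  have f: "f a \<in> \<F>" "a \<in> f a" if "a \<in> \<Union>\<F>" for a
  proof -
    have "f a \<in> {P \<in> \<F>. a \<in> P}"
      unfolding f_def using that Field_r by (intro wo_rel.minim_in[OF wo]) auto
    then show "f a \<in> \<F>" "a \<in> f a"
      by auto
  qed
  have small_UN: "nul (\<Union>\<F> \<inter> (\<Union>\<eta>\<in>{\<eta>. lt \<eta> \<xi>}. g \<eta>))"
    if \<xi>: "\<xi> \<in> \<F>" and g: "\<And>\<eta>. nul (g \<eta>)" for \<xi> g
  proof (rule ccontr)
    assume not_nul: "\<not> ?thesis"
    \<comment> \<open>Replacing the members below \<open>\<xi>\<close> by other null sets keeps the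
      family small, so minimality of \<open>\<F>\<close> still applies.\<close>
    define \<G> where "\<G> = (\<lambda>\<eta>. \<Union>\<F> \<inter> g \<eta>) ` underS r \<xi>"
    have "\<Union>\<G> = \<Union>\<F> \<inter> (\<Union>\<eta>\<in>{\<eta>. lt \<eta> \<xi>}. g \<eta>)"
      by (auto simp: \<G>_def lt_def)
    moreover have "nul P" if P: "P \<in> \<G>" for P
    proof -
      obtain \<eta> where "P = \<Union>\<F> \<inter> g \<eta>"
        using P by (auto simp: \<G>_def)
      then show ?thesis
        using nul_subset[OF g[of \<eta>]] by simp
    qed
    ultimately have "\<G> \<in> \<C>"
      using \<F> not_nul by (auto simp: \<C>_def)
    then have "|\<F>| \<le>o |\<G>|"
      by (rule min)
    moreover have "|\<G>| \<le>o |underS r \<xi>|"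
      unfolding \<G>_def by (rule card_of_image)
    moreover have "|underS r \<xi>| <o r"
      using card_of_underS[OF card_r] \<xi> Field_r by simp
    ultimately show False
      unfolding r_def using not_ordLess_ordLeq ordLeq_transitive by blast
  qed
  have below: "nul {b \<in> \<Union>\<F>. lt (f b) \<xi>}" if \<xi>: "\<xi> \<in> \<F>" for \<xi>
  proof -
    \<comment> \<open>The default \<open>{}\<close> makes the family null at every index, as
      \<open>small_UN\<close> demands.\<close>
    have "nul (if \<eta> \<in> \<F> then \<eta> else {})" for \<eta>
      using \<F> by (auto simp: \<C>_def)
    from small_UN[OF \<xi> this] show ?thesis
    proof (rule nul_subset, intro subsetI)
      fix b assume b: "b \<in> {b \<in> \<Union>\<F>. lt (f b) \<xi>}"
      then show "b \<in> \<Union>\<F> \<inter> (\<Union>\<eta>\<in>{\<eta>. lt \<eta> \<xi>}. if \<eta> \<in> \<F> then \<eta> else {})"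
        using f[of b] by auto
    qed
  qed
  have "ranked M (\<Union>\<F>) f lt"
  proof unfold_locales
    show "\<not> nul (\<Union>\<F>)"
      using \<F> by (simp add: \<C>_def)
    fix \<xi> assume "\<xi> \<in> f ` \<Union>\<F>"
    then have \<xi>: "\<xi> \<in> \<F>"
      using f by auto
    show "nul {b \<in> \<Union>\<F>. lt (f b) \<xi>}"
      using \<xi> by (rule below)
    show "nul (\<Union>\<F> \<inter> (\<Union>\<eta>\<in>{\<eta>. lt \<eta> \<xi>}. g \<eta>))" if "\<And>\<eta>. nul (g \<eta>)" for g
      using \<xi> that by (rule small_UN)
    have "nul \<xi>"
      using \<F> \<xi> by (auto simp: \<C>_def)
    from nul_Un[OF this below[OF \<xi>]] show "nul {a \<in> \<Union>\<F>. \<not> lt \<xi> (f a)}"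
    proof (rule nul_subset, intro subsetI)
      fix a assume "a \<in> {a \<in> \<Union>\<F>. \<not> lt \<xi> (f a)}"
      then have a: "a \<in> \<Union>\<F>" "\<not> lt \<xi> (f a)"
        by simp_all
      have "(\<xi>, f a) \<in> r \<or> (f a, \<xi>) \<in> r"
        using wo_rel.TOTALS[OF wo] f(1)[OF a(1)] \<xi> Field_r by blast
      then have "f a = \<xi> \<or> lt (f a) \<xi>"
        using a(2) by (auto simp: lt_def underS_def)
      then show "a \<in> \<xi> \<union> {b \<in> \<Union>\<F>. lt (f b) \<xi>}"
        using a(1) f(2)[OF a(1)] by auto
    qed
  qed
  then interpret ranked M "\<Union>\<F>" f lt .
  obtain x :: "real set \<Rightarrow> nat \<Rightarrow> bool" where x: "\<forall>B\<subseteq>\<Union>\<F>. \<not> nul B \<longrightarrow>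
      (\<exists>t. \<not> nul (env {a \<in> B. x (f a) t} \<inter> env {a \<in> B. \<not> x (f a) t}))"
    using ex_splitting_bits ..
  interpret coded M "\<Union>\<F>" f lt x
    by unfold_locales (use x in blast)
  show False
  proof (rule no_dense_sequence)
    show "F n \<inter> \<Union>\<F> \<subseteq> \<Union>\<F>" for n
      by blast
    fix D assume D: "D \<subseteq> \<Union>\<F>" "\<not> nul D"
    then have "D \<subseteq> A"
      using \<F> by (auto simp: \<C>_def)
    then obtain n E where E: "E \<in> sets M" "nul (F n \<inter> E - D)" "\<not> nul (F n \<inter> E)"
      using contra D(2) by metis
    \<comment> \<open>Since \<open>D \<subseteq> \<Union>\<F>\<close>, restricting the sets
      \<open>F n\<close> to \<open>\<Union>\<F>\<close> loses only a null part of
      \<open>F n \<inter> E\<close>.\<close>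
    have "F n \<inter> E \<subseteq> (F n \<inter> \<Union>\<F> \<inter> E) \<union> (F n \<inter> E - D)"
      using D(1) by blast
    then have "\<not> nul (F n \<inter> \<Union>\<F> \<inter> E)"
      using E(2,3) nul_Un nul_subset by metis
    moreover have "nul (F n \<inter> \<Union>\<F> \<inter> E - D)"
      by (rule nul_subset[OF E(2)]) blast
    ultimately show "\<exists>n. \<exists>E\<in>sets M. \<not> nul (F n \<inter> \<Union>\<F> \<inter> E) \<and> nul (F n \<inter> \<Union>\<F> \<inter> E - D)"
      using E(1) by blast
  qed
qed

section \<open>Exhaustion and gluing\<close>

lemma ex_maximal_set:
  assumes "P {}" "\<And>E. P E \<Longrightarrow> E \<in> sets M"
    and "\<And>E :: nat \<Rightarrow> real set. (\<And>i. P (E i)) \<Longrightarrow> P (\<Union>i. E i)"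
  obtains E where "P E" "\<And>E'. P E' \<Longrightarrow> nul (E' - E)"
proof -
  define s where "s = (SUP E\<in>Collect P. measure M E)"
  have bdd: "bdd_above (measure M ` Collect P)"
    by (rule bdd_aboveI2) (rule bounded_measure)
  have "\<exists>E. P E \<and> s - 1 / Suc i < measure M E" for i
  proof -
    have "s - 1 / Suc i < s"
      by simp
    then show ?thesis
      using less_cSUP_iff[OF _ bdd, of "s - 1 / Suc i"] assms(1) unfolding s_def by auto
  qed
  then obtain E where E: "\<And>i. P (E i)" "\<And>i. s - 1 / Suc i < measure M (E i)"
    by metis
  define U where "U = (\<Union>i. E i)"
  have U: "P U"
    unfolding U_def using E(1) by (rule assms(3))
  have "s - 1 / Suc i \<le> measure M U" for i
  proof -
    have "measure M (E i) \<le> measure M U"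
      using assms(2)[OF U] by (intro finite_measure_mono) (auto simp: U_def)
    then show ?thesis
      using E(2)[of i] by simp
  qed
  moreover have "(\<lambda>i. s - 1 / Suc i) \<longlonglongrightarrow> s - 0"
    by (intro tendsto_diff tendsto_const LIMSEQ_Suc[OF lim_1_over_n])
  ultimately have s: "s \<le> measure M U"
    by (intro LIMSEQ_le_const2[of _ s]) auto
  have "nul (E' - U)" if "P E'" for E'
  proof -
    \<comment> \<open>Binary unions come from countable ones; a non-null \<open>E' - U\<close> would
      push the measure above the supremum \<open>s\<close>.\<close>
    have "P (\<Union>i::nat. if i = 0 then U else E')"
      using U that by (intro assms(3)) auto
    moreover have "(\<Union>i::nat. if i = 0 then U else E') = U \<union> (E' - U)"
      by (auto split: if_splits)
    ultimately have "P (U \<union> (E' - U))"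
      by simp
    then have "measure M (U \<union> (E' - U)) \<le> s"
      unfolding s_def by (intro cSUP_upper bdd) auto
    moreover have "measure M (U \<union> (E' - U)) = measure M U + measure M (E' - U)"
      using assms(2)[OF U] assms(2)[OF that] by (intro finite_measure_Union) auto
    ultimately have "measure M (E' - U) = 0"
      using s measure_nonneg[of M "E' - U"] by linarith
    then show ?thesis
      using assms(2)[OF U] assms(2)[OF that] by (simp add: nul_measure)
  qed
  then show ?thesis
    using U that by blast
qed

text \<open>A set \<open>D\<close> from \<open>ex_not_dense\<close> solves the problem inside
  \<open>env D\<close>: removing it keeps every \<open>F n\<close> full there, and \<open>D\<close>
  is full there itself. Exhaustion extends this to almost all of \<open>A\<close>.\<close>

lemma ex_full_split:
  fixes F :: "nat \<Rightarrow> real set"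
  assumes F: "\<And>n. F n \<subseteq> A"
  shows "\<exists>C\<subseteq>A. (\<forall>n. nul (F n - env (F n \<inter> C))) \<and> nul (A - env (A - C))"
proof -
  define good where "good E C \<longleftrightarrow>
    (\<forall>n. nul (F n \<inter> E - env (F n \<inter> C))) \<and> nul (A \<inter> E - env (A - C))" for E C
  have cong: "nul (S \<inter> E - env (S \<inter> C))"
    if "E \<in> sets M" "nul (S \<inter> E - env (S \<inter> C'))" "C' \<inter> E \<subseteq> C" for S E C C'
  proof -
    have "S \<inter> C' \<inter> E - S \<inter> C = {}"
      using that(3) by blast
    then have "nul (env (S \<inter> C') \<inter> E - env (S \<inter> C))"
      using that(1) by (intro env_mono_Int) (simp_all only: nul_empty)
    from nul_Un[OF this that(2)] show ?thesis
      by (rule nul_subset) blast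
  qed
  have good_local: "good E C" if "E \<in> sets M" "good E' C'" "E \<subseteq> E'" "C \<inter> E = C' \<inter> E" for E E' C C'
  proof -
    have mono: "nul (S \<inter> E - T)" if "nul (S \<inter> E' - T)" for S T
      by (rule nul_subset[OF that]) (use \<open>E \<subseteq> E'\<close> in blast)
    have "nul (F n \<inter> E - env (F n \<inter> C))" for n
    proof (rule cong[OF \<open>E \<in> sets M\<close>])
      show "nul (F n \<inter> E - env (F n \<inter> C'))"
        by (rule mono) (use \<open>good E' C'\<close> in \<open>simp add: good_def\<close>)
    qed (use \<open>C \<inter> E = C' \<inter> E\<close> in blast)
    moreover have "nul (A \<inter> E - env (A \<inter> - C))"
    proof (rule cong[OF \<open>E \<in> sets M\<close>])
      show "nul (A \<inter> E - env (A \<inter> - C'))"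
        by (rule mono) (use \<open>good E' C'\<close> in \<open>simp add: good_def Diff_eq\<close>)
    qed (use \<open>C \<inter> E = C' \<inter> E\<close> in blast)
    ultimately show ?thesis
      by (simp add: good_def Diff_eq)
  qed
  have good_UN: "\<exists>C. good (\<Union>i. E i) C"
    if E: "\<And>i. E i \<in> sets M" "\<And>i. \<exists>C. good (E i) C" for E :: "nat \<Rightarrow> real set"
  proof -
    obtain C where C: "\<And>i. good (E i) (C i)"
      using E(2) by metis
    \<comment> \<open>Solutions restrict to measurable subsets (\<open>good_local\<close>), so they
      can be pasted along disjoint pieces.\<close>
    define C' where "C' = (\<Union>i. C i \<inter> disjointed E i)"
    have "good (disjointed E i) C'" for i
    proof (rule good_local[OF _ C])
      show "disjointed E i \<in> sets M"
        using sets.range_disjointed_sets[of E M] E(1) by blast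
      show "disjointed E i \<subseteq> E i"
        by (rule disjointed_subset)
      show "C' \<inter> disjointed E i = C i \<inter> disjointed E i"
      proof (intro equalityI subsetI)
        fix y assume "y \<in> C' \<inter> disjointed E i"
        then obtain j where j: "y \<in> C j" "y \<in> disjointed E j" "y \<in> disjointed E i"
          unfolding C'_def by blast
        then have "i = j"
          using disjoint_family_onD[OF disjoint_family_disjointed[of E], of i j] by blast
        with j show "y \<in> C i \<inter> disjointed E i"
          by simp
      qed (auto simp: C'_def)
    qed
    then have pieces: "nul (\<Union>i. F n \<inter> disjointed E i - env (F n \<inter> C'))"
      "nul (\<Union>i. A \<inter> disjointed E i - env (A - C'))" for n
      by (intro nul_UN; simp add: good_def)+
    have "good (\<Union>i. E i) C'"
      unfolding good_def UN_disjointed_eq[of E, symmetric]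
    proof (intro conjI allI)
      show "nul (F n \<inter> (\<Union>i. disjointed E i) - env (F n \<inter> C'))" for n
        by (rule nul_subset[OF pieces(1)[of n]]) blast
      show "nul (A \<inter> (\<Union>i. disjointed E i) - env (A - C'))"
        by (rule nul_subset[OF pieces(2)]) blast
    qed
    then show ?thesis ..
  qed
  obtain E where E: "E \<in> sets M" "\<exists>C. good E C"
    and max: "\<And>E'. E' \<in> sets M \<Longrightarrow> \<exists>C. good E' C \<Longrightarrow> nul (E' - E)"
  proof (rule ex_maximal_set[of "\<lambda>E. E \<in> sets M \<and> (\<exists>C. good E C)"])
    show "{} \<in> sets M \<and> (\<exists>C. good {} C)"
      by (auto simp: good_def)
    show "(\<Union>i. E i) \<in> sets M \<and> (\<exists>C. good (\<Union>i. E i) C)"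
      if "\<And>i. E i \<in> sets M \<and> (\<exists>C. good (E i) C)" for E :: "nat \<Rightarrow> real set"
      using that by (intro conjI sets.countable_UN good_UN) auto
  qed auto
  have "nul (A - E)"
  proof (rule ccontr)
    assume "\<not> nul (A - E)"
    then obtain D where D: "D \<subseteq> A - E" "\<not> nul D"
      and not_dense: "\<And>n E'. E' \<in> sets M \<Longrightarrow> nul ((F n - E) \<inter> E' - D) \<Longrightarrow> nul ((F n - E) \<inter> E')"
      using ex_not_dense[of "A - E" "\<lambda>n. F n - E"] by auto
    have "good (env D - E) (A - D)"
      unfolding good_def
    proof (intro conjI allI)
      fix n
      \<comment> \<open>On \<open>E'\<close> the set \<open>F n\<close> lies inside
        \<open>D\<close>, so the choice of \<open>D\<close> makes this part of \<open>F n\<close>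
        null.\<close>
      define E' where "E' = env D - E - env (F n \<inter> (A - D))"
      have "(F n - E) \<inter> E' \<subseteq> D"
        using env_superset[of "F n \<inter> (A - D)"] F[of n] by (auto simp: E'_def)
      then have empty: "(F n - E) \<inter> E' - D = {}"
        by blast
      have "nul ((F n - E) \<inter> E')"
      proof (rule not_dense)
        show "E' \<in> sets M"
          using E(1) by (simp add: E'_def sets.Diff)
        show "nul ((F n - E) \<inter> E' - D)"
          unfolding empty by (rule nul_empty)
      qed
      then show "nul (F n \<inter> (env D - E) - env (F n \<inter> (A - D)))"
        by (rule nul_subset) (auto simp: E'_def)
    next
      have "A - (A - D) = D"
        using D(1) by blast
      moreover have "A \<inter> (env D - E) - env D = {}"
        by blast
      ultimately show "nul (A \<inter> (env D - E) - env (A - (A - D)))"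
        by (simp only: nul_empty)
    qed
    then have "nul (env D - E - E)"
      using E(1) by (intro max) auto
    then have "nul D"
      by (rule nul_subset) (use D(1) env_superset[of D] in blast)
    then show False
      using D(2) by contradiction
  qed
  obtain C where C: "good E C"
    using E(2) by blast
  have "good E (A \<inter> C)"
  proof -
    have "F n \<inter> (A \<inter> C) = F n \<inter> C" "A - A \<inter> C = A - C" for n
      using F[of n] by blast+
    with C show ?thesis
      by (simp add: good_def)
  qed
  then have C': "nul (F n \<inter> E - env (F n \<inter> (A \<inter> C)))" "nul (A \<inter> E - env (A - A \<inter> C))" for n
    by (simp_all add: good_def)
  have "nul (F n - env (F n \<inter> (A \<inter> C)))" for n
    by (rule nul_subset[OF nul_Un[OF C'(1)[of n] \<open>nul (A - E)\<close>]]) (use F[of n] in blast)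
  moreover have "nul (A - env (A - A \<inter> C))"
    by (rule nul_subset[OF nul_Un[OF C'(2) \<open>nul (A - E)\<close>]]) blast
  ultimately show ?thesis
    by (intro exI[of _ "A \<inter> C"]) auto
qed

lemma nul_Diff_env_trans:
  assumes "nul (B - env C)" "nul (C - env D)"
  shows "nul (B - env D)"
proof -
  have "nul (env C - env D)"
    using assms(2) by (intro env_min) auto
  from nul_Un[OF this assms(1)] show ?thesis
    by (rule nul_subset) blast
qed

text \<open>\<open>W s\<close> collects the points used before stage \<open>s\<close>, with
  \<open>Y n - W s\<close> full in \<open>Y n\<close> for all \<open>n\<close>. By
  \<open>ex_full_split\<close>, \<open>Z s\<close> can be taken full in \<open>Y s\<close> while
  sparing enough of every \<open>Y n\<close>.\<close>

theorem ex_disjoint_full_refinement: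
  fixes Y :: "nat \<Rightarrow> real set"
  shows "\<exists>Z. disjoint_family Z \<and> (\<forall>n. Z n \<subseteq> Y n \<and> nul (Y n - env (Z n)))"
proof -
  have nul_Diff_env: "nul (B - env B)" for B
    by (rule nul_subset[OF nul_empty]) (use env_superset in blast)
  have "\<exists>W. \<forall>s. (\<forall>n. nul (Y n - env (Y n - W s))) \<and>
      (\<exists>Z\<subseteq>Y s - W s. W (Suc s) = W s \<union> Z \<and> nul (Y s - env Z))"
  proof (rule dependent_nat_choice)
    show "\<exists>W. \<forall>n. nul (Y n - env (Y n - W))"
      by (intro exI[of _ "{}"]) (simp add: nul_Diff_env)
    fix W s assume W: "\<forall>n. nul (Y n - env (Y n - W))"
    define A where "A = Y s - W"
    obtain C where C: "C \<subseteq> A" "\<And>n. nul ((Y n - W) \<inter> A - env ((Y n - W) \<inter> A \<inter> C))" "nul (A - env (A - C))"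
      using ex_full_split[of "\<lambda>n. (Y n - W) \<inter> A" A] by auto
    have "nul (Y n - env (Y n - (W \<union> (A - C))))" for n
    proof (rule nul_Diff_env_trans)
      show "nul (Y n - env (Y n - W))"
        using W by blast
      \<comment> \<open>Outside \<open>A\<close> nothing is removed; inside \<open>A\<close> the
        spared set \<open>C\<close> still meets \<open>Y n - W\<close> fully.\<close>
      have "(Y n - W) \<inter> A \<inter> C - (Y n - (W \<union> (A - C))) = {}"
        by blast
      then have "nul (env ((Y n - W) \<inter> A \<inter> C) - env (Y n - (W \<union> (A - C))))"
        by (intro env_mono) (simp only: nul_empty)
      from nul_Un[OF this C(2)] show "nul (Y n - W - env (Y n - (W \<union> (A - C))))"
        by (rule nul_subset) (use env_superset[of "Y n - (W \<union> (A - C))"] in blast)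
    qed
    moreover have "nul (Y s - env (A - C))"
    proof (rule nul_Diff_env_trans)
      show "nul (Y s - env A)"
        unfolding A_def by (rule spec[OF W])
    qed (rule C(3))
    moreover have "A - C \<subseteq> Y s - W"
      by (auto simp: A_def)
    ultimately show "\<exists>W'. (\<forall>n. nul (Y n - env (Y n - W'))) \<and> (\<exists>Z\<subseteq>Y s - W. W' = W \<union> Z \<and> nul (Y s - env Z))"
      by metis
  qed
  then obtain W where W: "\<And>s. \<exists>Z\<subseteq>Y s - W s. W (Suc s) = W s \<union> Z \<and> nul (Y s - env Z)"
    by blast
  define Z where "Z s = W (Suc s) - W s" for s
  have Z: "Z s \<subseteq> Y s \<and> nul (Y s - env (Z s))" for s
  proof -
    obtain Z' where Z': "Z' \<subseteq> Y s - W s" "W (Suc s) = W s \<union> Z'" "nul (Y s - env Z')"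
      using W[of s] by blast
    then have "Z s = Z'"
      by (auto simp: Z_def)
    then show ?thesis
      using Z' by blast
  qed
  have W_mono: "W s \<subseteq> W t" if "s \<le> t" for s t
    using that by (rule lift_Suc_mono_le[rotated]) (use W in blast)
  have "Z s \<inter> Z t = {}" if "s < t" for s t
    using W_mono[of "Suc s" t] that by (auto simp: Z_def)
  then have "disjoint_family Z"
    unfolding disjoint_family_on_def by (metis inf_commute linorder_neqE_nat)
  with Z show ?thesis
    by blast
qed

end

subsection \<open>Avoiding rational distances\<close>

text \<open>A strictly positive integrable density makes Lebesgue measure finite and keeps its null
  sets.\<close>

lemma ex_finite_lborel: "\<exists>M. finite_lborel M"
proof -
  have "\<exists>h :: real \<Rightarrow> real. h \<in> borel_measurable lborel \<and> (\<forall>x. h x > 0) \<and> integrable lborel h"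
    by (rule sigma_finite_measure.obtain_positive_integrable_function[OF sigma_finite_lborel])
      (intro exI conjI allI; assumption)
  then obtain h :: "real \<Rightarrow> real" where h [measurable]: "h \<in> borel_measurable lborel"
    and h_pos: "\<And>x. h x > 0" and h_int: "integrable lborel h"
    by blast
  define M where "M = density lborel (\<lambda>x. ennreal (h x))"
  have "finite_lborel M"
  proof (intro finite_lborel.intro finite_lborel_axioms.intro finite_measureI)
    have "emeasure M (space M) = (\<integral>\<^sup>+x. ennreal (h x) \<partial>lborel)"
      by (simp add: M_def emeasure_density)
    also have "\<dots> = ennreal (\<integral>x. h x \<partial>lborel)"
      using h_int h_pos by (intro nn_integral_eq_integral) (auto simp: less_imp_le)
    finally show "emeasure M (space M) \<noteq> \<infinity>"
      by simp
    show "sets M = sets borel"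
      by (simp add: M_def)
    have "A \<in> null_sets M \<longleftrightarrow> A \<in> null_sets lborel" for A
      unfolding M_def using h_pos
      by (subst null_sets_density_iff) (auto simp: ennreal_eq_0_iff not_le[symmetric] AE_iff_null_sets[symmetric] AE_not_in)
    then show "null_sets M = null_sets lborel"
      by blast
  qed
  then show ?thesis ..
qed

text \<open>\<open>E\<close> is a Borel superset of \<open>B\<close>, so \<open>A - E\<close> is
  null. Hence \<open>F - E\<close> is, up to a null set, a measurable subset of
  \<open>F - A\<close>, and \<open>E - F\<close> is one of \<open>E - B\<close>.\<close>

lemma (in finite_lborel) full_in_if_nul_Diff_env:
  assumes "B \<subseteq> A" "nul (A - env B)"
  shows "full_in B A"
proof -
  obtain E F where E: "gdelta_envelope B E" and F: "gdelta_envelope A F"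
    using gdelta_envelope_exists by blast
  have sets: "E \<in> sets lebesgue" "F \<in> sets lebesgue"
    using E F by (simp_all add: gdelta_envelope_def gdelta_in_sets_lebesgue)
  have "gdelta E"
    using E by (simp add: gdelta_envelope_def)
  then have "E \<in> sets M"
  proof cases
    case (1 U)
    have "U n \<in> sets M" for n
      using 1 by (simp add: sets_M)
    then show ?thesis
      unfolding 1(1) by (intro sets.countable_INT) auto
  qed
  moreover have "B - E = {}"
    using E by (auto simp: gdelta_envelope_def)
  ultimately have "nul (env B - E)"
    by (intro env_min) (simp_all only: nul_empty)
  from nul_Un[OF assms(2) this] have AE: "nul (A - E)"
    by (rule nul_subset) blast
  have nul_inner: "nul S" if "gdelta_envelope C G" "S \<in> sets lebesgue" "S \<subseteq> G - C" for C G S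
  proof -
    have "\<forall>S \<in> sets lebesgue. S \<subseteq> G - C \<longrightarrow> emeasure lebesgue S = 0"
      using that(1) by (simp add: gdelta_envelope_def inner_measure_of_eq_0_iff)
    then show ?thesis
      using that(2,3) by (simp add: nul_iff_lebesgue null_sets_def)
  qed
  have "nul (E - F)"
    using F assms(1) sets by (intro nul_inner[OF E] sets.Diff) (auto simp: gdelta_envelope_def)
  moreover have "nul (F - E)"
  proof -
    have "A - E \<in> sets lebesgue"
      using AE by (auto simp: nul_iff_lebesgue)
    from sets.Diff[OF sets.Diff[OF sets(2,1)] this] have "nul (F - E - (A - E))"
      by (rule nul_inner[OF F]) blast
    from nul_Un[OF this AE] show ?thesis
      by (rule nul_subset) blast
  qed
  ultimately have "nul (E - F \<union> (F - E))"
    by (rule nul_Un)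
  then show ?thesis
    using assms(1) by (simp add: full_in_iff[OF E F] nul_iff_lebesgue)
qed

text \<open>\<open>M\<close> need not be translation invariant, but its null ideal is that of
  Lebesgue measure.\<close>

lemma (in finite_lborel) nul_translation:
  assumes "nul S"
  shows "nul ((+) c ` S)"
  using negligible_translation[of S c] assms
  by (simp add: nul_iff_lebesgue negligible_iff_null_sets)

theorem theorem3p1:
  fixes X :: "real set"
  assumes "outer_measure_of lebesgue X > 0"
  shows "\<exists>Y \<subseteq> X. full_in Y X \<and>
           (\<forall>y \<in> Y. \<forall>y' \<in> Y. y \<noteq> y' \<longrightarrow> \<bar>y - y'\<bar> \<notin> \<rat>)"
proof -
  obtain M where "finite_lborel M"
    using ex_finite_lborel by blast
  then interpret finite_lborel M .
  \<comment> \<open>The choice depends only on the predicate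
    \<open>\<lambda>r. y - r \<in> \<rat>\<close>, which is the same throughout a coset of the
    rationals.\<close>
  define rep :: "real \<Rightarrow> real" where "rep y = (SOME r. y - r \<in> \<rat>)" for y
  have rep: "y - rep y \<in> \<rat>" for y
    unfolding rep_def by (rule someI[of _ y]) simp
  have rep_cong: "rep y = rep y'" if "y - y' \<in> \<rat>" for y y'
  proof -
    have "y - r \<in> \<rat> \<longleftrightarrow> y' - r \<in> \<rat>" for r
      using Rats_add[OF that, of "y' - r"] Rats_diff[of "y - r", OF _ that] by auto
    then show ?thesis
      by (simp add: rep_def)
  qed
  have rep_unique: "t = t'" if t: "t \<in> range rep" "t' \<in> range rep" "t - t' \<in> \<rat>" for t t'
  proof -
    obtain y y' where y: "t = rep y" "t' = rep y'"
      using t by blast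
    have "y - y' = (y - rep y) + (t - t') - (y' - rep y')"
      by (simp add: y)
    then have "y - y' \<in> \<rat>"
      using rep t(3) by (metis Rats_add Rats_diff)
    then show ?thesis
      using rep_cong y by simp
  qed
  define q where "q = from_nat_into (\<rat> :: real set)"
  have q: "range q = \<rat>"
    unfolding q_def by (rule range_from_nat_into) (use Rats_0 in \<open>auto intro: countable_rat\<close>)
  define Y where "Y n = {t \<in> range rep. q n + t \<in> X}" for n
  obtain Z where Z_disj: "disjoint_family Z" and Z: "\<And>n. Z n \<subseteq> Y n" "\<And>n. nul (Y n - env (Z n))"
    using ex_disjoint_full_refinement[of Y] by blast
  define Y' where "Y' = (\<Union>n. (+) (q n) ` Z n)"
  have sub: "Y' \<subseteq> X"
    using Z(1) by (auto simp: Y'_def Y_def)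
  have "nul (X - env Y')"
  proof -
    \<comment> \<open>The shifted envelope is a Borel set containing \<open>Z n\<close>, so by
      fullness it contains almost all of \<open>Y n\<close>.\<close>
    define E where "E n = (+) (q n) -` env Y'" for n
    have "nul (Y n - E n)" for n
    proof -
      have "Z n - E n = {}"
        using env_superset[of Y'] by (auto simp: E_def Y'_def)
      moreover have "E n \<in> sets M"
      proof -
        have "(+) (q n) \<in> measurable M M"
          by measurable
        from measurable_sets[OF this env_sets[of Y']] show ?thesis
          by (simp add: E_def)
      qed
      ultimately have "nul (env (Z n) - E n)"
        by (intro env_min) (simp_all only: nul_empty)
      from nul_Un[OF this Z(2)[of n]] show ?thesis
        by (rule nul_subset) blast
    qed
    then have "nul (\<Union>n. (+) (q n) ` (Y n - E n))"
      by (intro nul_UN nul_translation) auto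
    then show ?thesis
    proof (rule nul_subset[OF _ subsetI])
      fix y assume y: "y \<in> X - env Y'"
      obtain n where "y - rep y = q n"
        using rep[of y] q by (metis rangeE)
      then have "y = q n + rep y"
        by simp
      then show "y \<in> (\<Union>n. (+) (q n) ` (Y n - E n))"
        using y by (intro UN_I[of n] image_eqI[of _ _ "rep y"]) (auto simp: Y_def E_def)
    qed
  qed
  with sub have "full_in Y' X"
    by (rule full_in_if_nul_Diff_env)
  moreover have "\<bar>y - y'\<bar> \<notin> \<rat>" if y: "y \<in> Y'" "y' \<in> Y'" "y \<noteq> y'" for y y'
  proof
    assume "\<bar>y - y'\<bar> \<in> \<rat>"
    then have rat: "y - y' \<in> \<rat>"
      by (simp add: abs_if split: if_splits) (metis Rats_minus_iff minus_diff_eq)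
    obtain m n z z' where m: "y = q m + z" "z \<in> Z m" and n: "y' = q n + z'" "z' \<in> Z n"
      using y by (auto simp: Y'_def)
    have "q m \<in> \<rat>" "q n \<in> \<rat>"
      using q by blast+
    moreover have "z - z' = (y - y') - q m + q n"
      by (simp add: m n)
    ultimately have "z - z' \<in> \<rat>"
      using rat by simp
    moreover have "z \<in> range rep" "z' \<in> range rep"
      using m(2) n(2) Z(1) by (auto simp: Y_def)
    \<comment> \<open>Representatives at rational distance coincide; disjointness of the sets
      \<open>Z n\<close> then makes the shifts equal.\<close>
    ultimately have "z = z'"
      by (intro rep_unique)
    then have "m = n"
      using m(2) n(2) disjoint_family_onD[OF Z_disj, of m n] by auto
    then show False
      using y(3) \<open>z = z'\<close> m n by simp
  qed
  ultimately show ?thesis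
    using sub by blast
qed

end
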